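(* Let $n\ge 3$ and let $(a^*,b^* )\in\mathbb{R}^2$, $R^*>0$. Let $x_i^*=a^*+R^*\cos\varphi_i$, $y_i^*=b^*+R^*\sin\varphi_i$ for $i=1,\dots,n$ be points on the circle with center $(a^*,b^* )$ and radius $R^*$, where the angles $\varphi_1,\dots,\varphi_n\in[0,2\pi]$ are either fixed (functional model) or independent realizations of a random variable with some probability distribution on $[0,2\pi]$, independent of the errors below (structural model). Let the observed points be $x_i=x_i^*+\delta_i$, $y_i=y_i^*+\varepsilon_i$, $i=1,\dots,n$, where $(\delta_1,\varepsilon_1),\dots,(\delta_n,\varepsilon_n)$ are independent random vectors in $\mathbb{R}^2$ (not necessarily identically distributed and not necessarily of zero mean). Suppose that, for each $i$, the probability distribution of $(\delta_i,\varepsilon_i)$ has a continuous strictly positive density on $\mathbb{R}^2$. Let $(\hat a,\hat b,\hat R)$ be the parameters of the best fitting circle to $(x_1,y_1),\dots,(x_n,y_n)$ in the sense of orthogonal least squares (as defined in the context). Then $\hat a,\hat b,\hat R$ do not have moments, i.e. $$E(|\hat a|)=E(|\hat b|)=E(\hat R)=\infty.$$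
   Context: For data points $(x_1,y_1),\dots,(x_n,y_n)\in\mathbb{R}^2$, the geometric (orthogonal least squares) circle fit is $$(\hat a,\hat b,\hat R)=\operatorname{argmin}\,\mathcal{F}(a,b,R),\qquad \mathcal{F}(a,b,R)=\sum_{i=1}^n\Bigl[\sqrt{(x_i-a)^2+(y_i-b)^2}-R\Bigr]^2,$$ where $(a,b)$ is the center and $R$ the radius of the fitted circle. Conventions. The fitting problem is posed in the extended sense: one looks for a circle or a line minimizing the sum of squared orthogonal distances to the data points. Such a best fitting contour (a circle or a line) always exists, but need not be unique. If there are several best fits, any one of them may be selected (by any rule for which $\hat a,\hat b,\hat R$ are extended-real-valued random variables); the theorem is asserted for any selection. If the best fit is a line rather than a circle, one sets $\hat a=\hat b=\hat R=\infty$. *)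

theory Defs
  imports "HOL-Probability.Probability"
begin

definition circle_obj ::
  "nat \<Rightarrow> (nat \<Rightarrow> real) \<Rightarrow> (nat \<Rightarrow> real) \<Rightarrow> real \<Rightarrow> real \<Rightarrow> real \<Rightarrow> real" where
  "circle_obj n x y a b R = (\<Sum>i=1..n. (sqrt ((x i - a)\<^sup>2 + (y i - b)\<^sup>2) - R)\<^sup>2)"

definition is_line :: "(real \<times> real) set \<Rightarrow> bool" where
  "is_line L \<longleftrightarrow> (\<exists>A B C. (A \<noteq> 0 \<or> B \<noteq> 0) \<and> L = {(u, v). A * u + B * v = C})"

definition line_obj :: "nat \<Rightarrow> (nat \<Rightarrow> real) \<Rightarrow> (nat \<Rightarrow> real) \<Rightarrow> (real \<times> real) set \<Rightarrow> real" where
  "line_obj n x y L = (\<Sum>i=1..n. (infdist (x i, y i) L)\<^sup>2)"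

text \<open>The lower bounds range over the competing contours: all circles of positive radius
  and all lines.\<close>

definition best_circle ::
  "nat \<Rightarrow> (nat \<Rightarrow> real) \<Rightarrow> (nat \<Rightarrow> real) \<Rightarrow> real \<Rightarrow> real \<Rightarrow> real \<Rightarrow> bool" where
  "best_circle n x y a b R \<longleftrightarrow> R > 0 \<and>
     (\<forall>a' b' R'. R' > 0 \<longrightarrow> circle_obj n x y a b R \<le> circle_obj n x y a' b' R') \<and>
     (\<forall>L. is_line L \<longrightarrow> circle_obj n x y a b R \<le> line_obj n x y L)"

definition best_line :: "nat \<Rightarrow> (nat \<Rightarrow> real) \<Rightarrow> (nat \<Rightarrow> real) \<Rightarrow> (real \<times> real) set \<Rightarrow> bool" where
  "best_line n x y L \<longleftrightarrow> is_line L \<and>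
     (\<forall>a' b' R'. R' > 0 \<longrightarrow> line_obj n x y L \<le> circle_obj n x y a' b' R') \<and>
     (\<forall>L'. is_line L' \<longrightarrow> line_obj n x y L \<le> line_obj n x y L')"

text \<open>Best fits need not be unique, so this is a relation between the data and the possible
  values of the estimates. All three parameters of a best fitting line are \<open>\<infinity>\<close> by convention.\<close>

definition best_fit_params ::
  "nat \<Rightarrow> (nat \<Rightarrow> real) \<Rightarrow> (nat \<Rightarrow> real) \<Rightarrow> ereal \<Rightarrow> ereal \<Rightarrow> ereal \<Rightarrow> bool" where
  "best_fit_params n x y a b R \<longleftrightarrow>
     (\<exists>a' b' R'. best_circle n x y a' b' R' \<and> a = ereal a' \<and> b = ereal b' \<and> R = ereal R') \<or>
     ((\<exists>L. best_line n x y L) \<and> a = \<infinity> \<and> b = \<infinity> \<and> R = \<infinity>)"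

definition functional_model :: "'w measure \<Rightarrow> nat \<Rightarrow> (nat \<Rightarrow> 'w \<Rightarrow> real) \<Rightarrow> bool" where
  "functional_model M n \<phi> \<longleftrightarrow>
     (\<exists>c. \<forall>i\<in>{1..n}. c i \<in> {0..2 * pi} \<and> (\<forall>\<omega>\<in>space M. \<phi> i \<omega> = c i))"

text \<open>The angle vector and the error vector have different value types, which \<open>indep_var\<close> does not
  admit, so their independence is stated through the generated sigma-algebras.\<close>

definition structural_model ::
  "'w measure \<Rightarrow> nat \<Rightarrow> (nat \<Rightarrow> 'w \<Rightarrow> real) \<Rightarrow> (nat \<Rightarrow> 'w \<Rightarrow> real \<times> real) \<Rightarrow> bool" where
  "structural_model M n \<phi> err \<longleftrightarrow>
     prob_space.indep_vars M (\<lambda>_. borel) \<phi> {1..n} \<and>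
     (\<exists>Q. prob_space Q \<and> sets Q = sets borel \<and> emeasure Q {0..2 * pi} = 1 \<and>
          (\<forall>i\<in>{1..n}. distr M borel (\<phi> i) = Q)) \<and>
     prob_space.indep_set M
       (sets (vimage_algebra (space M) (\<lambda>\<omega>. \<lambda>i\<in>{1..n}. \<phi> i \<omega>) (\<Pi>\<^sub>M i\<in>{1..n}. borel)))
       (sets (vimage_algebra (space M) (\<lambda>\<omega>. \<lambda>i\<in>{1..n}. err i \<omega>) (\<Pi>\<^sub>M i\<in>{1..n}. borel)))"

end

theory Submission imports Defs begin

text \<open>
  Write a circle of curvature \<open>\<kappa> = 1/R\<close> in a frame \<open>(u, v)\<close> whose \<open>u\<close>-axis is the total least
  squares (TLS) line of the data, so that \<open>\<Sum>v\<^sub>i = \<Sum>u\<^sub>i v\<^sub>i = 0\<close>. The residuals \<open>d\<^sub>i\<close> of the circle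
  satisfy \<open>d + \<kappa>d\<^sup>2/2 = \<kappa>(u\<^sup>2 + v\<^sup>2)/2 + \<alpha>u + \<beta>v + \<gamma>\<close> with \<open>\<alpha>\<^sup>2 + \<beta>\<^sup>2 = 1 + 2\<kappa>\<gamma>\<close>. If the data are
  nearly collinear and the circle is at least as good as the line, then expanding
  \<open>\<Sum>d\<^sub>i\<^sup>2 \<le> \<Sum>v\<^sub>i\<^sup>2\<close> around the line gives \<open>\<kappa>\<^sup>2 \<le> C \<kappa> |h|\<close> with \<open>h = \<Sum>u\<^sub>i\<^sup>2 v\<^sub>i\<close>: the linear terms in
  \<open>\<alpha>\<close> and \<open>\<gamma>\<close> drop out. Hence \<open>R\<close>, and for a line of slope near 1 also both coordinates of the
  centre, are at least a constant times \<open>1/|h|\<close>.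

  On a box of data around three collinear positions, \<open>h\<close> is Lipschitz in the second coordinate of the
  first point and changes sign along it, so \<open>1/|h|\<close> has infinite integral over every such segment.
  The density of the errors is bounded below on compact sets, whence the expectations are infinite
  for every fixed choice of the angles; random angles are integrated out at the end.
\<close>

section \<open>Circles that fit nearly collinear data\<close>

text \<open>A quadratic polynomial is controlled by its values at three separated nodes; here the
  nodes are at least 3/4 apart. The chord slopes yield k, then al, then g, with constants 5, 3 and 2
  that add up to 10.\<close>

lemma interpolation_bound:
  fixes k al g u1 u2 u3 :: real
  defines "q \<equiv> \<lambda>u. k * u\<^sup>2 / 2 + al * u + g"
  assumes "-2 \<le> u1" "u1 \<le> -1" "1 \<le> u2" "u2 \<le> 2" "\<bar>u3\<bar> \<le> 1/4"
  shows "\<bar>k\<bar> + \<bar>al\<bar> + \<bar>g\<bar> \<le> 10 * (\<bar>q u1\<bar> + \<bar>q u2\<bar> + \<bar>q u3\<bar>)"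
proof -
  define S where "S = \<bar>q u1\<bar> + \<bar>q u2\<bar> + \<bar>q u3\<bar>"
  have e1: "q u2 - q u1 = (u2 - u1) * (k/2*(u1+u2) + al)"
    unfolding q_def by (simp add: field_simps power2_eq_square)
  have e2: "q u2 - q u3 = (u2 - u3) * (k/2*(u3+u2) + al)"
    unfolding q_def by (simp add: field_simps power2_eq_square)
  have b1: "2 * \<bar>k/2*(u1+u2) + al\<bar> \<le> \<bar>q u2 - q u1\<bar>"
    unfolding e1 abs_mult by (rule mult_right_mono) (use assms in auto)
  have b2: "3/4 * \<bar>k/2*(u3+u2) + al\<bar> \<le> \<bar>q u2 - q u3\<bar>"
    unfolding e2 abs_mult by (rule mult_right_mono) (use assms in auto)
  \<comment> \<open>The difference of two chord slopes of q is a second divided difference and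
    isolates k.\<close>
  have "\<bar>k/2*(u1-u3)\<bar> = \<bar>(k/2*(u1+u2) + al) - (k/2*(u3+u2) + al)\<bar>"
    by (rule arg_cong[of _ _ abs]) (simp add: field_simps)
  also have "\<dots> \<le> \<bar>k/2*(u1+u2) + al\<bar> + \<bar>k/2*(u3+u2) + al\<bar>" by (rule abs_triangle_ineq4)
  finally have "\<bar>k/2*(u1-u3)\<bar> \<le> \<bar>q u2 - q u1\<bar>/2 + 4/3*\<bar>q u2 - q u3\<bar>" using b1 b2 by linarith
  moreover have "3/4 * \<bar>k/2\<bar> \<le> \<bar>k/2*(u1-u3)\<bar>"
    unfolding abs_mult mult.commute[of "3/4"] by (rule mult_left_mono) (use assms in auto)
  ultimately have "3/4 * \<bar>k/2\<bar> \<le> \<bar>q u2 - q u1\<bar>/2 + 4/3*\<bar>q u2 - q u3\<bar>" by (rule order.trans[rotated])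
  \<comment> \<open>Collects the constants: the value at u2 occurs in both differences and has the
    largest coefficient, and 4/3 * (1/2 + 4/3) is below 5/2.\<close>
  moreover have "2 * K \<le> 5 * (a + b + c)"
    if "3/4 * K \<le> D1/2 + 4/3 * D2" "D1 \<le> b + a" "D2 \<le> b + c" "0 \<le> a" "0 \<le> b" "0 \<le> c"
    for K D1 D2 a b c :: real using that by argo
  ultimately have "2 * \<bar>k/2\<bar> \<le> 5 * S" unfolding S_def
    using abs_triangle_ineq4 abs_ge_zero by blast
  then have k: "\<bar>k\<bar> \<le> 5 * S" by simp
  have "\<bar>k/2*(u1+u2)\<bar> \<le> \<bar>k/2\<bar> * 1"
    unfolding abs_mult by (rule mult_left_mono) (use assms in auto)
  moreover have "\<bar>al\<bar> \<le> \<bar>k/2*(u1+u2) + al\<bar> + \<bar>k/2*(u1+u2)\<bar>"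
    using abs_triangle_ineq4[of "k/2*(u1+u2) + al" "k/2*(u1+u2)"] by simp
  moreover have "\<bar>q u2 - q u1\<bar> \<le> S" unfolding S_def by linarith
  moreover have "\<bar>k/2\<bar> * 1 = \<bar>k\<bar> / 2" by simp
  ultimately have al: "\<bar>al\<bar> \<le> 3 * S" using b1 k by argo
  have u3: "u3\<^sup>2 \<le> (1/4)\<^sup>2" using assms(6) by (metis abs_ge_zero power2_abs power_mono)
  have "\<bar>k * u3\<^sup>2 / 2\<bar> \<le> \<bar>k\<bar> / 32" using mult_left_mono[OF u3, of "\<bar>k\<bar>"] by (simp add: abs_mult power2_eq_square mult_ac)
  moreover have "\<bar>al * u3\<bar> \<le> \<bar>al\<bar> / 4" using mult_left_mono[OF assms(6), of "\<bar>al\<bar>"] by (simp add: abs_mult)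
  moreover have "g = q u3 - k * u3\<^sup>2/2 - al * u3" unfolding q_def by simp
  ultimately have "\<bar>g\<bar> \<le> \<bar>q u3\<bar> + \<bar>k\<bar>/32 + \<bar>al\<bar>/4" by linarith
  moreover have "\<bar>q u3\<bar> \<le> S" unfolding S_def by linarith
  ultimately have "\<bar>g\<bar> \<le> 2 * S" using k al by argo
  then show ?thesis using k al unfolding S_def by linarith
qed

text \<open>The factor \<open>1 / (10000 n\<^sup>2)\<close> makes every error term that arises from the nonlinear part of the
  residual equation small against the quadratic form \<open>\<Sum>w\<^sub>i\<^sup>2\<close>, where \<open>w = d - v\<close>.\<close>

lemma curvature_bound_oriented:
  fixes u v d :: "nat \<Rightarrow> real" and k al be g :: real and n :: nat
  defines "t \<equiv> \<bar>k\<bar> + \<bar>al\<bar> + \<bar>g\<bar>"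
  assumes n: "3 \<le> n"
    and v: "\<And>i. i \<in> {1..n} \<Longrightarrow> \<bar>v i\<bar> \<le> 1 / (10000 * (real n)\<^sup>2)"
    and u: "-2 \<le> u 1" "u 1 \<le> -1" "1 \<le> u 2" "u 2 \<le> 2" "\<bar>u 3\<bar> \<le> 1/4"
    and v0: "(\<Sum>i=1..n. v i) = 0" and uv0: "(\<Sum>i=1..n. u i * v i) = 0"
    and k: "0 < k" and be: "0 \<le> be" and nrm: "al\<^sup>2 + be\<^sup>2 = 1 + 2 * k * g"
    and eq: "\<And>i. i \<in> {1..n} \<Longrightarrow>
        d i + k * (d i)\<^sup>2 / 2 = k * ((u i)\<^sup>2 + (v i)\<^sup>2) / 2 + al * u i + be * v i + g"
    and fit: "(\<Sum>i=1..n. (d i)\<^sup>2) \<le> (\<Sum>i=1..n. (v i)\<^sup>2)"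
  shows "k \<le> 10800 * \<bar>\<Sum>i=1..n. (u i)\<^sup>2 * v i\<bar>" "t \<le> 1/100"
proof -
  define N where "N = real n"
  \<comment> \<open>The assumed bound on \<open>v i\<close> is E / N. The spare factor N makes the
    sum of the squares at most E^2, so that \<open>fit\<close> bounds every single residual
    \<open>d i\<close> by E.\<close>
  define E where "E = 1 / (10000 * N)"
  define q where "q i = k * (u i)\<^sup>2 / 2 + al * u i + g" for i
  define w where "w i = d i - v i" for i
  define h where "h = (\<Sum>i=1..n. (u i)\<^sup>2 * v i)"
  have N: "3 \<le> N" using n by (simp add: N_def)
  have E: "0 < E" "E \<le> 1/30000" using N by (simp_all add: E_def field_simps)
  have I: "1 \<in> {1..n}" "2 \<in> {1..n}" "3 \<in> {1..n}" using n by auto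
  have NE: "N * E\<^sup>2 \<le> 1/100000000" using N by (simp add: E_def field_simps power2_eq_square)
  have t0: "0 \<le> t" "\<bar>k\<bar> \<le> t" "\<bar>al\<bar> \<le> t" "\<bar>g\<bar> \<le> t" using k by (auto simp: t_def)
  have vE': "\<bar>v i\<bar> \<le> E / N" if "i \<in> {1..n}" for i
    using v[OF that] by (simp add: E_def N_def power2_eq_square mult_ac)
  have "E / N \<le> E" using N E by (simp add: field_simps)
  then have vE: "\<bar>v i\<bar> \<le> E" if "i \<in> {1..n}" for i using vE'[OF that] by linarith
  have "(\<Sum>i=1..n. (v i)\<^sup>2) \<le> (\<Sum>i=1..n. (E/N)\<^sup>2)"
    by (rule sum_mono) (metis vE' abs_ge_zero power2_abs power_mono)
  also have "\<dots> = E\<^sup>2 / N" using N by (simp add: N_def power2_eq_square)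
  also have "\<dots> \<le> E\<^sup>2" using N E by (simp add: field_simps)
  finally have sv: "(\<Sum>i=1..n. (v i)\<^sup>2) \<le> E\<^sup>2" .
  have dE: "\<bar>d i\<bar> \<le> E" if "i \<in> {1..n}" for i
  proof -
    have "(d i)\<^sup>2 \<le> (\<Sum>i=1..n. (d i)\<^sup>2)" by (rule member_le_sum[OF that]) auto
    then have "(d i)\<^sup>2 \<le> E\<^sup>2" using fit sv by linarith
    then show ?thesis using E by (simp add: abs_le_square_iff[symmetric])
  qed
  have kg: "\<bar>2 * k * g\<bar> + al\<^sup>2 \<le> t\<^sup>2"
    unfolding t_def power2_sum by (simp add: abs_mult power2_eq_square algebra_simps)
  \<comment> \<open>Dividing be^2 - 1 by be + 1, which is at least 1 by the orientation be >= 0,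
    shows that be differs from 1 only to second order in t.\<close>
  have be1: "\<bar>be - 1\<bar> \<le> t\<^sup>2"
  proof -
    have "\<bar>be - 1\<bar> * 1 \<le> \<bar>be - 1\<bar> * \<bar>be + 1\<bar>" by (rule mult_left_mono) (use be in auto)
    also have "\<dots> = \<bar>2 * k * g - al\<^sup>2\<bar>"
      using nrm by (simp add: abs_mult[symmetric] algebra_simps power2_eq_square)
    finally show ?thesis using kg abs_triangle_ineq4[of "2 * k * g" "al\<^sup>2"] by simp
  qed
  have be2: "be \<le> 1 + t"
  proof (rule power2_le_imp_le)
    have "be\<^sup>2 \<le> 1 + t\<^sup>2" using nrm kg abs_ge_self[of "2 * k * g"] zero_le_power2[of al] by linarith
    then show "be\<^sup>2 \<le> (1+t)\<^sup>2" using t0 by (simp add: power2_sum)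
  qed (use t0 in auto)
  have E2: "E\<^sup>2 \<le> E" using E by (simp add: power2_eq_square mult_left_le)
  have q1: "q i = d i - be * v i + k * ((d i)\<^sup>2 - (v i)\<^sup>2) / 2" if "i \<in> {1..n}" for i
    using eq[OF that] unfolding q_def by (simp add: field_simps)
  have qE: "\<bar>q i\<bar> \<le> 2 * E + 2 * t * E" if "i \<in> {1..n}" for i
  proof -
    have "\<bar>(d i)\<^sup>2 - (v i)\<^sup>2\<bar> \<le> E\<^sup>2"
      using power_mono[OF dE[OF that], of 2] power_mono[OF vE[OF that], of 2]
        zero_le_power2[of "d i"] zero_le_power2[of "v i"] unfolding power2_abs by linarith
    then have "\<bar>(d i)\<^sup>2 - (v i)\<^sup>2\<bar> \<le> E" using E2 by linarith
    then have "k * \<bar>(d i)\<^sup>2 - (v i)\<^sup>2\<bar> \<le> t * E" by (intro mult_mono) (use t0 k in auto)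
    then have 1: "\<bar>k * ((d i)\<^sup>2 - (v i)\<^sup>2) / 2\<bar> \<le> t * E"
      using k mult_nonneg_nonneg[OF t0(1) less_imp_le[OF E(1)]] unfolding abs_mult abs_divide by simp
    have "be * \<bar>v i\<bar> \<le> (1 + t) * E" by (intro mult_mono) (use vE[OF that] be2 be t0 in auto)
    then have "\<bar>be * v i\<bar> \<le> E + t * E" using be by (simp add: abs_mult algebra_simps)
    then show ?thesis using 1 dE[OF that] q1[OF that] by linarith
  qed
  have tq: "t \<le> 10 * (\<bar>q 1\<bar> + \<bar>q 2\<bar> + \<bar>q 3\<bar>)"
    unfolding t_def q_def by (rule interpolation_bound) (use u in auto)
  have tE: "t * E \<le> t * (1/30000)" by (rule mult_left_mono) (use E t0 in auto)
  \<comment> \<open>Bootstrap: the crude bound on q gives t <= 60 * E * (1 + t) with 60 * E <=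
    1/500, so the t on the right is absorbed.\<close>
  show t1: "t \<le> 1/100" 
  proof -
    have "t \<le> 10 * (3 * (2 * E + 2 * (t * E)))"
      using tq qE[OF I(1)] qE[OF I(2)] qE[OF I(3)] by (simp add: mult.assoc)
    then show ?thesis using E tE by argo
  qed
  \<comment> \<open>Since d^2 - v^2 = w * (d + v), the polynomial q agrees with w up to terms that
    carry an additional small factor.\<close>
  have qw: "w i = q i + (be - 1) * v i - k * w i * (d i + v i) / 2" if "i \<in> {1..n}" for i
    using q1[OF that] unfolding w_def by (simp add: field_simps power2_eq_square)
  have qw2: "\<bar>q i\<bar> \<le> 2 * \<bar>w i\<bar> + t * E" if "i \<in> {1..n}" for i
  proof -
    have "\<bar>be - 1\<bar> * \<bar>v i\<bar> \<le> t\<^sup>2 * E" by (intro mult_mono) (use be1 vE[OF that] in auto)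
    also have "\<dots> \<le> t * E" using t0 t1 E by (intro mult_right_mono) (auto simp: power2_eq_square mult_left_le)
    finally have 1: "\<bar>(be - 1) * v i\<bar> \<le> t * E" by (simp add: abs_mult)
    have "k * \<bar>w i\<bar> * \<bar>d i + v i\<bar> \<le> 1 * \<bar>w i\<bar> * 1"
      by (intro mult_mono) (use k t0 t1 vE[OF that] dE[OF that] E in auto)
    then have "\<bar>k * w i * (d i + v i) / 2\<bar> \<le> \<bar>w i\<bar>" using k by (simp add: abs_mult)
    then show ?thesis using 1 qw[OF that] by linarith
  qed
  define W where "W = (\<Sum>i=1..n. (w i)\<^sup>2)"
  have tW: "t \<le> 30 * (\<bar>w 1\<bar> + \<bar>w 2\<bar> + \<bar>w 3\<bar>)"
    using tq qw2[OF I(1)] qw2[OF I(2)] qw2[OF I(3)] tE t0(1)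
      abs_ge_zero[of "w 1"] abs_ge_zero[of "w 2"] abs_ge_zero[of "w 3"] by argo
  have "t\<^sup>2 \<le> (30 * (\<bar>w 1\<bar> + \<bar>w 2\<bar> + \<bar>w 3\<bar>))\<^sup>2" using tW t0 by (intro power_mono)
  \<comment> \<open>Cauchy-Schwarz for three terms: 2700 = 3 * 30^2.\<close>
  also have "\<dots> \<le> 2700 * ((w 1)\<^sup>2 + (w 2)\<^sup>2 + (w 3)\<^sup>2)"
  proof -
    have "0 \<le> (\<bar>w 1\<bar> - \<bar>w 2\<bar>)\<^sup>2 + (\<bar>w 1\<bar> - \<bar>w 3\<bar>)\<^sup>2 + (\<bar>w 2\<bar> - \<bar>w 3\<bar>)\<^sup>2" by simp
    then have "(\<bar>w 1\<bar> + \<bar>w 2\<bar> + \<bar>w 3\<bar>)\<^sup>2 \<le> 3 * (\<bar>w 1\<bar>\<^sup>2 + \<bar>w 2\<bar>\<^sup>2 + \<bar>w 3\<bar>\<^sup>2)"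
      by (simp only: power2_eq_square) (simp add: algebra_simps)
    then show ?thesis unfolding power_mult_distrib power2_abs by simp
  qed
  also have "\<dots> = 2700 * (\<Sum>i\<in>{1,2,3}. (w i)\<^sup>2)" by simp
  also have "\<dots> \<le> 2700 * W" unfolding W_def
    by (intro mult_left_mono sum_mono2) (use n in auto)
  finally have tW2: "t\<^sup>2 \<le> 2700 * W" .
  \<comment> \<open>Expanding d = v + w turns the comparison of the two objectives into an upper
    bound for W that is linear in w.\<close>
  have "(d i)\<^sup>2 - (v i)\<^sup>2 = (w i)\<^sup>2 + 2 * (v i * w i)" for i
    unfolding w_def by (simp add: power2_eq_square algebra_simps)
  then have "W + 2 * (\<Sum>i=1..n. v i * w i) = (\<Sum>i=1..n. (d i)\<^sup>2) - (\<Sum>i=1..n. (v i)\<^sup>2)"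
    unfolding W_def sum_distrib_left by (simp add: sum.distrib[symmetric] sum_subtractf[symmetric])
  then have W1: "W \<le> - 2 * (\<Sum>i=1..n. v i * w i)" using fit by linarith
  \<comment> \<open>Inserting the formula for w, the coefficients al and g multiply
    \<open>uv0\<close> and \<open>v0\<close> and disappear; to first order only the curvature term k
    * h / 2 survives.\<close>
  have "(\<Sum>i=1..n. v i * w i) = (\<Sum>i=1..n. k/2 * ((u i)\<^sup>2 * v i) + al * (u i * v i) + g * v i
      + (be - 1) * (v i)\<^sup>2 - k/2 * (v i * w i * (d i + v i)))"
  proof (rule sum.cong)
    fix i assume "i \<in> {1..n}"
    from arg_cong[OF qw[OF this], of "\<lambda>z. v i * z"]
    show "v i * w i = k/2 * ((u i)\<^sup>2 * v i) + al * (u i * v i) + g * v i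
      + (be - 1) * (v i)\<^sup>2 - k/2 * (v i * w i * (d i + v i))"
      unfolding q_def by (simp add: algebra_simps add_divide_distrib power2_eq_square)
  qed simp
  also have "\<dots> = k/2 * h + (be - 1) * (\<Sum>i=1..n. (v i)\<^sup>2) - k/2 * (\<Sum>i=1..n. v i * w i * (d i + v i))"
    unfolding sum.distrib sum_subtractf sum_distrib_left[symmetric] v0 uv0 h_def by simp
  finally have W2: "W \<le> - k * h - 2 * ((be - 1) * (\<Sum>i=1..n. (v i)\<^sup>2))
      + k * (\<Sum>i=1..n. v i * w i * (d i + v i))" using W1 by linarith
  have 1: "- k * h \<le> k * \<bar>h\<bar>" using k by (metis abs_ge_minus_self mult_left_mono less_imp_le mult_minus_left mult_minus_right)
  have "\<bar>be - 1\<bar> * (\<Sum>i=1..n. (v i)\<^sup>2) \<le> t\<^sup>2 * E\<^sup>2"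
    by (intro mult_mono be1 sv sum_nonneg) auto
  then have 2: "- 2 * ((be - 1) * (\<Sum>i=1..n. (v i)\<^sup>2)) \<le> 2 * (t\<^sup>2 * E\<^sup>2)"
    using abs_ge_minus_self[of "(be - 1) * (\<Sum>i=1..n. (v i)\<^sup>2)"]
    unfolding abs_mult abs_of_nonneg[OF sum_nonneg[OF zero_le_power2]] by linarith
  \<comment> \<open>Young's inequality for k * |w i| splits this error into a t^2 part and a w^2
    part, both with the small factor E^2.\<close>
  have "k * (v i * w i * (d i + v i)) \<le> E\<^sup>2 * (t\<^sup>2 + (w i)\<^sup>2)" if "i \<in> {1..n}" for i
  proof -
    have "\<bar>v i\<bar> * \<bar>d i + v i\<bar> \<le> E * (2 * E)"
      by (intro mult_mono) (use vE[OF that] dE[OF that] E in auto)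
    moreover have "k * \<bar>w i\<bar> \<le> (t\<^sup>2 + (w i)\<^sup>2) / 2"
    proof -
      have "k * \<bar>w i\<bar> \<le> t * \<bar>w i\<bar>" using t0 k by (intro mult_right_mono) auto
      also have "\<dots> \<le> (t\<^sup>2 + (w i)\<^sup>2) / 2"
        using zero_le_power2[of "t - \<bar>w i\<bar>"] by (simp add: power2_diff)
      finally show ?thesis .
    qed
    ultimately have "(\<bar>v i\<bar> * \<bar>d i + v i\<bar>) * (k * \<bar>w i\<bar>) \<le> (E * (2*E)) * ((t\<^sup>2 + (w i)\<^sup>2) / 2)"
      by (rule mult_mono) (use k E in auto)
    moreover have "k * (v i * w i * (d i + v i)) \<le> \<bar>k * (v i * w i * (d i + v i))\<bar>" by simp
    moreover have "\<bar>k * (v i * w i * (d i + v i))\<bar> = (\<bar>v i\<bar> * \<bar>d i + v i\<bar>) * (k * \<bar>w i\<bar>)"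
      using k by (simp add: abs_mult mult_ac)
    moreover have "(E * (2*E)) * ((t\<^sup>2 + (w i)\<^sup>2) / 2) = E\<^sup>2 * (t\<^sup>2 + (w i)\<^sup>2)"
      by (simp add: power2_eq_square)
    ultimately show ?thesis by linarith
  qed
  then have "k * (\<Sum>i=1..n. v i * w i * (d i + v i)) \<le> (\<Sum>i=1..n. E\<^sup>2 * (t\<^sup>2 + (w i)\<^sup>2))"
    unfolding sum_distrib_left by (intro sum_mono) auto
  also have "\<dots> = N * E\<^sup>2 * t\<^sup>2 + E\<^sup>2 * W"
    by (simp add: N_def W_def sum_distrib_left sum.distrib algebra_simps)
  finally have 3: "k * (\<Sum>i=1..n. v i * w i * (d i + v i)) \<le> N * E\<^sup>2 * t\<^sup>2 + E\<^sup>2 * W" .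
  have W0: "0 \<le> W" unfolding W_def by (intro sum_nonneg) auto
  have "t\<^sup>2 * E\<^sup>2 \<le> t\<^sup>2 * (1/100000000)"
  proof (intro mult_left_mono)
    have "1 * E\<^sup>2 \<le> N * E\<^sup>2" using N by (intro mult_right_mono) auto
    then show "E\<^sup>2 \<le> 1/100000000" using NE by linarith
  qed simp
  moreover have "N * E\<^sup>2 * t\<^sup>2 \<le> (1/100000000) * t\<^sup>2" by (intro mult_right_mono NE) simp
  moreover have "E\<^sup>2 * W \<le> (1/30000) * W" using E E2 W0 by (intro mult_right_mono) auto
  \<comment> \<open>With t^2 <= 2700 * W all terms on the right except k * |h| are absorbed by W.
    Then k^2 <= t^2 is at most a constant times k * |h|, and one factor k cancels.\<close>
  ultimately have "W \<le> k * \<bar>h\<bar> + 3/100000000 * t\<^sup>2 + (1/30000) * W" using W2 1 2 3 by linarith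
  then have "t\<^sup>2 \<le> 10800 * (k * \<bar>h\<bar>)" using tW2 W0 by linarith
  moreover have "k * k \<le> t\<^sup>2" unfolding power2_eq_square using t0 k by (intro mult_mono) auto
  ultimately have "k * k \<le> k * (10800 * \<bar>h\<bar>)" by linarith
  then show "k \<le> 10800 * \<bar>\<Sum>i=1..n. (u i)\<^sup>2 * v i\<bar>" using k unfolding h_def by simp
qed

text \<open>Squaring R + d = distance to the centre and dividing by 2 * R gives the residual
  equation of the oriented version. A reflection in the u-axis produces be >= 0. The last three
  bounds say that the centre is far away and lies nearly perpendicular to the line.\<close>

lemma curvature_bound:
  fixes u v :: "nat \<Rightarrow> real" and A B R :: real and n :: nat
  assumes n: "3 \<le> n" and R: "0 < R"
    and v: "\<And>i. i \<in> {1..n} \<Longrightarrow> \<bar>v i\<bar> \<le> 1 / (10000 * (real n)\<^sup>2)"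
    and u: "-2 \<le> u 1" "u 1 \<le> -1" "1 \<le> u 2" "u 2 \<le> 2" "\<bar>u 3\<bar> \<le> 1/4"
    and v0: "(\<Sum>i=1..n. v i) = 0" and uv0: "(\<Sum>i=1..n. u i * v i) = 0"
    and fit: "(\<Sum>i=1..n. (sqrt ((u i - A)\<^sup>2 + (v i - B)\<^sup>2) - R)\<^sup>2) \<le> (\<Sum>i=1..n. (v i)\<^sup>2)"
  shows "1 / R \<le> 10800 * \<bar>\<Sum>i=1..n. (u i)\<^sup>2 * v i\<bar>"
    and "100 \<le> R" and "\<bar>A\<bar> \<le> R / 10" and "9/10 * R \<le> \<bar>B\<bar>"
proof -
  define s :: real where "s = (if B \<le> 0 then 1 else -1)"
  define k where "k = 1 / R"
  define al where "al = - A / R"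
  define be where "be = \<bar>B\<bar> / R"
  define g where "g = (A\<^sup>2 + B\<^sup>2 - R\<^sup>2) / (2 * R)"
  define d where "d i = sqrt ((u i - A)\<^sup>2 + (v i - B)\<^sup>2) - R" for i
  have s: "s * s = 1" "\<bar>s\<bar> = 1" "s * B = - \<bar>B\<bar>" by (auto simp: s_def)
  have nrm: "al\<^sup>2 + be\<^sup>2 = 1 + 2 * k * g"
    using R by (simp add: al_def be_def k_def g_def field_simps power2_eq_square)
  have eq: "d i + k * (d i)\<^sup>2 / 2 = k * ((u i)\<^sup>2 + (s * v i)\<^sup>2) / 2 + al * u i + be * (s * v i) + g" for i
  proof -
    have "(R + d i)\<^sup>2 = (u i - A)\<^sup>2 + (v i - B)\<^sup>2" unfolding d_def by simp
    moreover have "\<bar>B\<bar> * (s * v i) = - (B * v i)" using s by (auto simp: s_def)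
    moreover have "(s * v i)\<^sup>2 = (v i)\<^sup>2" using s by (auto simp: s_def)
    ultimately show ?thesis using R unfolding al_def be_def k_def g_def
      by (simp add: divide_simps) (simp add: algebra_simps power2_eq_square)
  qed
  have sq: "(\<Sum>i=1..n. (s * v i)\<^sup>2) = (\<Sum>i=1..n. (v i)\<^sup>2)" by (rule sum.cong) (auto simp: s_def)
  have s1: "(\<Sum>i=1..n. u i * (s * v i)) = s * (\<Sum>i=1..n. u i * v i)"
    "(\<Sum>i=1..n. s * v i) = s * (\<Sum>i=1..n. v i)"
    "(\<Sum>i=1..n. (u i)\<^sup>2 * (s * v i)) = s * (\<Sum>i=1..n. (u i)\<^sup>2 * v i)"
    unfolding sum_distrib_left by (simp_all add: mult_ac)
  have 1: "k \<le> 10800 * \<bar>\<Sum>i=1..n. (u i)\<^sup>2 * (s * v i)\<bar>" and t: "\<bar>k\<bar> + \<bar>al\<bar> + \<bar>g\<bar> \<le> 1/100"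
  proof -
    have *: "\<bar>s * v i\<bar> \<le> 1 / (10000 * (real n)\<^sup>2)" if "i \<in> {1..n}" for i
      using v[OF that] s by (simp add: abs_mult)
    have "0 < k" "0 \<le> be" using R by (auto simp: k_def be_def)
    note C = curvature_bound_oriented[where v="\<lambda>i. s * v i" and d=d and u=u, OF n * u _ _ this nrm eq]
    show "k \<le> 10800 * \<bar>\<Sum>i=1..n. (u i)\<^sup>2 * (s * v i)\<bar>"
      by (rule C(1)) (use v0 uv0 fit in \<open>simp_all only: s1 sq d_def mult_zero_right\<close>)
    show "\<bar>k\<bar> + \<bar>al\<bar> + \<bar>g\<bar> \<le> 1/100"
      by (rule C(2)) (use v0 uv0 fit in \<open>simp_all only: s1 sq d_def mult_zero_right\<close>)
  qed
  show "1 / R \<le> 10800 * \<bar>\<Sum>i=1..n. (u i)\<^sup>2 * v i\<bar>" 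
    using 1 unfolding s1 abs_mult s k_def by simp
  have "k \<le> 1/100" using t by linarith
  then show "100 \<le> R" using R by (simp add: k_def field_simps)
  have "\<bar>al\<bar> \<le> 1/10" using t by linarith
  then show "\<bar>A\<bar> \<le> R / 10" using R by (simp add: al_def field_simps abs_divide)
  have al2: "al\<^sup>2 \<le> 1/100" using power_mono[OF \<open>\<bar>al\<bar> \<le> 1/10\<close>, of 2] by (simp add: power2_eq_square)
  have "\<bar>k * g\<bar> \<le> 1/100 * (1/100)" unfolding abs_mult by (intro mult_mono) (use t in auto)
  then have "- (1/10000) \<le> k * g" by (simp add: abs_le_iff)
  \<comment> \<open>be^2 = 1 + 2 * k * g - al^2 is at least 1 - 2/10000 - 1/100.\<close>
  then have "(9/10)\<^sup>2 \<le> be\<^sup>2" using al2 nrm by (simp add: power2_eq_square)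
  then have "9/10 \<le> be" using R by (intro power2_le_imp_le[of "9/10" be]) (auto simp: be_def)
  then show "9/10 * R \<le> \<bar>B\<bar>" using R by (simp add: be_def field_simps)
qed

section \<open>Total least squares line of the data\<close>

definition mean :: "nat \<Rightarrow> (nat \<Rightarrow> real) \<Rightarrow> real" where
  "mean n f = (\<Sum>i=1..n. f i) / real n"

definition scov :: "nat \<Rightarrow> (nat \<Rightarrow> real) \<Rightarrow> (nat \<Rightarrow> real) \<Rightarrow> real" where
  "scov n f g = (\<Sum>i=1..n. (f i - mean n f) * (g i - mean n g))"

text \<open>The slope of the TLS line is the positive root of
  \<open>S\<^sub>x\<^sub>y (1 - m\<^sup>2) + m (S\<^sub>y\<^sub>y - S\<^sub>x\<^sub>x) = 0\<close>; for \<open>S\<^sub>x\<^sub>y < 0\<close> that root is not the least squares slope.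
  The coordinates along and across the line below are left unnormalized, that is, they carry an
  extra factor \<open>sqrt (1 + m\<^sup>2)\<close>.\<close>

definition tls_slope :: "nat \<Rightarrow> (nat \<Rightarrow> real) \<Rightarrow> (nat \<Rightarrow> real) \<Rightarrow> real" where
  "tls_slope n x y = (let r = (scov n y y - scov n x x) / (2 * scov n x y) in r + sqrt (1 + r\<^sup>2))"

definition tls_res :: "nat \<Rightarrow> (nat \<Rightarrow> real) \<Rightarrow> (nat \<Rightarrow> real) \<Rightarrow> nat \<Rightarrow> real" where
  "tls_res n x y i = (y i - mean n y) - tls_slope n x y * (x i - mean n x)"

definition tls_pos :: "nat \<Rightarrow> (nat \<Rightarrow> real) \<Rightarrow> (nat \<Rightarrow> real) \<Rightarrow> nat \<Rightarrow> real" where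
  "tls_pos n x y i = (x i - mean n x) + tls_slope n x y * (y i - mean n y)"

definition tls_curv :: "nat \<Rightarrow> (nat \<Rightarrow> real) \<Rightarrow> (nat \<Rightarrow> real) \<Rightarrow> real" where
  "tls_curv n x y = (\<Sum>i=1..n. (tls_pos n x y i)\<^sup>2 * tls_res n x y i)"

lemma sum_deviations: "(\<Sum>i=1..n. f i - mean n f) = 0"
  by (cases "n = 0") (simp_all add: mean_def sum_subtractf)

lemma sum_tls_res: "(\<Sum>i=1..n. tls_res n x y i) = 0"
  unfolding tls_res_def sum_subtractf[of _ _ "{1..n}"] sum_distrib_left[symmetric]
  using sum_deviations[of y n] sum_deviations[of x n] by (simp add: sum_subtractf)

text \<open>For every r, the number r + sqrt (1 + r^2) is a root of m^2 - 2 * r * m - 1; multiplying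
  by the covariance clears the denominator of r.\<close>

lemma tls_slope_eq:
  assumes "scov n x y \<noteq> 0"
  shows "scov n x y * (1 - (tls_slope n x y)\<^sup>2) + tls_slope n x y * (scov n y y - scov n x x) = 0"
proof -
  define r where "r = (scov n y y - scov n x x) / (2 * scov n x y)"
  have m: "tls_slope n x y = r + sqrt (1 + r\<^sup>2)" by (simp add: tls_slope_def r_def Let_def)
  have "(sqrt (1 + r\<^sup>2))\<^sup>2 = 1 + r\<^sup>2" by (simp add: add_nonneg_nonneg)
  then have "1 - (tls_slope n x y)\<^sup>2 + tls_slope n x y * (2 * r) = 0"
    unfolding m by (simp add: power2_eq_square algebra_simps)
  moreover have "scov n y y - scov n x x = scov n x y * (2 * r)" using assms by (simp add: r_def)
  ultimately show ?thesis by (metis distrib_left mult.left_commute mult_zero_right)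
qed

text \<open>The normal equation of the TLS line: the sum expands to the left-hand side of the slope
  equation. It provides the orthogonality that removes the first-order effect of rotating the
  line.\<close>

lemma sum_tls_pos_res:
  assumes "scov n x y \<noteq> 0"
  shows "(\<Sum>i=1..n. tls_pos n x y i * tls_res n x y i) = 0"
proof -
  let ?m = "tls_slope n x y"
  have "tls_pos n x y i * tls_res n x y i =
      (1 - ?m\<^sup>2) * ((x i - mean n x) * (y i - mean n y))
      + ?m * ((y i - mean n y) * (y i - mean n y)) - ?m * ((x i - mean n x) * (x i - mean n x))" for i
    unfolding tls_pos_def tls_res_def by (simp add: algebra_simps power2_eq_square)
  then have "(\<Sum>i=1..n. tls_pos n x y i * tls_res n x y i) =
      (1 - ?m\<^sup>2) * scov n x y + ?m * scov n y y - ?m * scov n x x"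
    unfolding scov_def sum_distrib_left by (simp add: sum.distrib sum_subtractf)
  then show ?thesis using tls_slope_eq[OF assms] by (simp add: algebra_simps)
qed

text \<open>An upper bound suffices, because a best circle is compared with this one line
  only.\<close>

lemma tls_line_obj:
  obtains L where "is_line L"
    "line_obj n x y L \<le> (\<Sum>i=1..n. (tls_res n x y i / sqrt (1 + (tls_slope n x y)\<^sup>2))\<^sup>2)"
proof
  let ?m = "tls_slope n x y"
  define L where "L = {(u, v). (- ?m) * u + 1 * v = mean n y - ?m * mean n x}"
  show "is_line L" unfolding is_line_def L_def
    by (intro exI[of _ "- ?m"] exI[of _ 1] exI[of _ "mean n y - ?m * mean n x"]) auto
  show "line_obj n x y L \<le> (\<Sum>i=1..n. (tls_res n x y i / sqrt (1 + ?m\<^sup>2))\<^sup>2)"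
    unfolding line_obj_def
  proof (rule sum_mono)
    fix i
    let ?e = "tls_res n x y i"
    let ?q = "1 + ?m\<^sup>2"
    have q: "?q > 0" by (simp add: add_pos_nonneg)
    \<comment> \<open>The foot of the perpendicular from the data point to the line.\<close>
    let ?p = "(x i + ?m * (?e / ?q), y i - ?e / ?q)"
    have "- ?m * (x i + ?m * (?e / ?q)) + (y i - ?e / ?q) = y i - ?m * x i - ?q * (?e / ?q)"
      by (simp add: algebra_simps add_divide_distrib power2_eq_square)
    also have "\<dots> = mean n y - ?m * mean n x"
    proof -
      have "?q * (?e / ?q) = ?e" using q by simp
      then show ?thesis by (simp only: tls_res_def) (simp add: algebra_simps)
    qed
    finally have "?p \<in> L" unfolding L_def by simp
    then have "infdist (x i, y i) L \<le> dist (x i, y i) ?p" by (rule infdist_le)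
    also have "\<dots> = sqrt ((?m * (?e / ?q))\<^sup>2 + (?e / ?q)\<^sup>2)"
      by (simp add: dist_Pair_Pair dist_real_def power_divide)
    finally have "(infdist (x i, y i) L)\<^sup>2 \<le> (sqrt ((?m * (?e / ?q))\<^sup>2 + (?e / ?q)\<^sup>2))\<^sup>2"
      by (intro power_mono) (auto simp: infdist_nonneg)
    also have "\<dots> = (?m * (?e / ?q))\<^sup>2 + (?e / ?q)\<^sup>2" by (simp add: sum_power2_ge_zero)
    also have "\<dots> = ?q * (?e / ?q)\<^sup>2" by (simp only: power_mult_distrib) (simp add: algebra_simps)
    also have "\<dots> = (?e / sqrt ?q)\<^sup>2" using q by (simp add: power_divide) (simp add: power2_eq_square)
    finally show "(infdist (x i, y i) L)\<^sup>2 \<le> (?e / sqrt ?q)\<^sup>2" .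
  qed
qed

text \<open>Division by sqrt (1 + m^2) turns the unnormalized coordinates into a rotated frame in
  which \<open>curvature_bound\<close> applies. For a slope near 1 the normal of the line is nearly
  diagonal, so a distant centre has both coordinates large.\<close>

lemma best_circle_bound:
  assumes n: "3 \<le> n" and best: "best_circle n x y a b R"
    and cov: "scov n x y \<noteq> 0"
    and m: "9/10 \<le> tls_slope n x y" "tls_slope n x y \<le> 11/10"
    and mean: "\<bar>mean n x\<bar> \<le> 1" "\<bar>mean n y\<bar> \<le> 1"
    and res: "\<And>i. i \<in> {1..n} \<Longrightarrow> \<bar>tls_res n x y i\<bar> \<le> 1 / (10000 * (real n)\<^sup>2)"
    and pos: "\<bar>tls_pos n x y 1 + 2\<bar> \<le> 1/10" "\<bar>tls_pos n x y 2 - 2\<bar> \<le> 1/10" "\<bar>tls_pos n x y 3\<bar> \<le> 1/10"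
  shows "1 / R \<le> 10800 * \<bar>tls_curv n x y\<bar>" and "R / 8 \<le> \<bar>a\<bar>" and "R / 8 \<le> \<bar>b\<bar>"
proof -
  define m where "m = tls_slope n x y"
  define k where "k = sqrt (1 + m\<^sup>2)"
  define u where "u i = tls_pos n x y i / k" for i
  define v where "v i = tls_res n x y i / k" for i
  define X where "X = a - mean n x"
  define Y where "Y = b - mean n y"
  define A where "A = (X + m * Y) / k"
  define B where "B = (Y - m * X) / k"
  have R: "0 < R" using best by (simp add: best_circle_def)
  have k2: "k\<^sup>2 = 1 + m\<^sup>2" by (simp add: k_def add_nonneg_nonneg)
  have mb: "9/10 \<le> m" "m \<le> 11/10" using m by (auto simp: m_def)
  have "(9/10)\<^sup>2 \<le> m\<^sup>2" "m\<^sup>2 \<le> (11/10)\<^sup>2" using mb by (auto intro: power_mono)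
  then have "(4/3)\<^sup>2 \<le> k\<^sup>2" "k\<^sup>2 \<le> (3/2)\<^sup>2" unfolding k2 by (auto simp: power2_eq_square)
  moreover have "0 \<le> k" by (simp add: k_def)
  ultimately have k: "4/3 \<le> k" "k \<le> 3/2"
    by (auto intro: power2_le_imp_le[of "4/3" k] power2_le_imp_le[of k "3/2"])
  have eq: "(u i - A)\<^sup>2 + (v i - B)\<^sup>2 = (x i - a)\<^sup>2 + (y i - b)\<^sup>2" for i
  proof -
    have 1: "u i - A = ((x i - a) + m * (y i - b)) / k" "v i - B = ((y i - b) - m * (x i - a)) / k"
      unfolding u_def v_def A_def B_def tls_pos_def tls_res_def m_def[symmetric] X_def Y_def
      by (simp_all add: diff_divide_distrib[symmetric] algebra_simps)
    have "(u i - A)\<^sup>2 + (v i - B)\<^sup>2 = ((x i - a)\<^sup>2 + (y i - b)\<^sup>2) * (1 + m\<^sup>2) / k\<^sup>2"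
      unfolding 1 power_divide add_divide_distrib[symmetric]
      by (rule arg_cong[of _ _ "\<lambda>z. z / k\<^sup>2"]) (simp add: algebra_simps power2_eq_square)
    then show ?thesis using k unfolding k2[symmetric] by simp
  qed
  obtain L where L: "is_line L" "line_obj n x y L \<le> (\<Sum>i=1..n. (v i)\<^sup>2)"
    using tls_line_obj[of n x y] unfolding v_def k_def m_def by blast
  have "circle_obj n x y a b R \<le> line_obj n x y L" using best L by (auto simp: best_circle_def)
  then have fit: "(\<Sum>i=1..n. (sqrt ((u i - A)\<^sup>2 + (v i - B)\<^sup>2) - R)\<^sup>2) \<le> (\<Sum>i=1..n. (v i)\<^sup>2)"
    using L(2) unfolding eq circle_obj_def by linarith
  have v: "\<bar>v i\<bar> \<le> 1 / (10000 * (real n)\<^sup>2)" if "i \<in> {1..n}" for i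
  proof -
    have "\<bar>v i\<bar> \<le> \<bar>tls_res n x y i\<bar> / 1" unfolding v_def abs_divide using k by (intro divide_left_mono) auto
    then show ?thesis using res[OF that] by linarith
  qed
  \<comment> \<open>Divided by k in [4/3, 3/2], positions near -2, 2 and 0 fall into the windows
    required by the interpolation bound.\<close>
  have u: "-2 \<le> u 1" "u 1 \<le> -1" "1 \<le> u 2" "u 2 \<le> 2" "\<bar>u 3\<bar> \<le> 1/4"
  proof -
    have "-21/10 \<le> tls_pos n x y 1" "tls_pos n x y 1 \<le> -19/10"
      "19/10 \<le> tls_pos n x y 2" "tls_pos n x y 2 \<le> 21/10" using pos by linarith+
    then show "-2 \<le> u 1" "u 1 \<le> -1" "1 \<le> u 2" "u 2 \<le> 2" "\<bar>u 3\<bar> \<le> 1/4"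
      using pos(3) k by (auto simp: u_def field_simps)
  qed
  have v0: "(\<Sum>i=1..n. v i) = 0" unfolding v_def sum_divide_distrib[symmetric] sum_tls_res by simp
  have "(\<Sum>i=1..n. u i * v i) = (\<Sum>i=1..n. tls_pos n x y i * tls_res n x y i) / (k * k)"
    unfolding u_def v_def sum_divide_distrib by simp
  then have uv0: "(\<Sum>i=1..n. u i * v i) = 0" using sum_tls_pos_res[OF cov] by simp
  note C = curvature_bound[OF n R v u v0 uv0 fit]
  \<comment> \<open>The curvature term is homogeneous of degree three, and k >= 1, so normalizing
    only decreases it.\<close>
  have "(\<Sum>i=1..n. (u i)\<^sup>2 * v i) = tls_curv n x y / k ^ 3"
    unfolding u_def v_def tls_curv_def sum_divide_distrib
    by (simp add: power_divide power3_eq_cube power2_eq_square mult_ac)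
  moreover have "\<bar>tls_curv n x y\<bar> / k ^ 3 \<le> \<bar>tls_curv n x y\<bar> / 1"
    using k by (intro divide_left_mono) (auto intro: one_le_power)
  ultimately have "\<bar>\<Sum>i=1..n. (u i)\<^sup>2 * v i\<bar> \<le> \<bar>tls_curv n x y\<bar>" using k by (simp add: abs_divide)
  then show "1 / R \<le> 10800 * \<bar>tls_curv n x y\<bar>" using C(1) by linarith
  have XY: "X = (A - m * B) / k" "Y = (B + m * A) / k"
  proof -
    have "k * (A - m * B) = X * (1 + m\<^sup>2)" "k * (B + m * A) = Y * (1 + m\<^sup>2)"
      unfolding A_def B_def using k by (simp_all add: field_simps power2_eq_square)
    then have "k * (A - m * B) = k * (k * X)" "k * (B + m * A) = k * (k * Y)"
      unfolding k2[symmetric] by (simp_all add: power2_eq_square mult_ac)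
    then have "A - m * B = k * X" "B + m * A = k * Y" using k by auto
    then show "X = (A - m * B) / k" "Y = (B + m * A) / k" using k by simp_all
  qed
  \<comment> \<open>In both coordinates the B part dominates the A part, leaving at least 7/10 * R
    before division by k. The means, at most 1 in absolute value, are then absorbed by R >=
    100.\<close>
  have "9/10 * (9/10 * R) \<le> m * \<bar>B\<bar>" using C(4) mb R by (intro mult_mono) auto
  then have mB: "81/100 * R \<le> \<bar>m * B\<bar>" using mb by (simp add: abs_mult)
  have "m * \<bar>A\<bar> \<le> 11/10 * (R/10)" using C(3) mb R by (intro mult_mono) auto
  then have mA: "\<bar>m * A\<bar> \<le> 11/100 * R" using mb by (simp add: abs_mult)
  have "7/10 * R \<le> \<bar>A - m * B\<bar>" using mB C(3) by linarith
  moreover have "\<bar>A - m * B\<bar> = k * \<bar>X\<bar>" using k XY(1) by (simp add: abs_divide)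
  moreover have "k * \<bar>X\<bar> \<le> 3/2 * \<bar>X\<bar>" using k by (intro mult_right_mono) auto
  ultimately have "7/15 * R \<le> \<bar>X\<bar>" by linarith
  then show "R / 8 \<le> \<bar>a\<bar>" using mean C(2) unfolding X_def by linarith
  have "7/10 * R \<le> \<bar>B + m * A\<bar>" using mA C(4) by linarith
  moreover have "\<bar>B + m * A\<bar> = k * \<bar>Y\<bar>" using k XY(2) by (simp add: abs_divide)
  moreover have "k * \<bar>Y\<bar> \<le> 3/2 * \<bar>Y\<bar>" using k by (intro mult_right_mono) auto
  ultimately have "7/15 * R \<le> \<bar>Y\<bar>" by linarith
  then show "R / 8 \<le> \<bar>b\<bar>" using mean C(2) unfolding Y_def by linarith
qed

text \<open>86400 = 8 * 10800, where the factor 8 is lost between R and a coordinate of the centre.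
  The first two hypotheses force h to be nonzero.\<close>

lemma inverse_ennreal_le:
  fixes h R z :: real
  assumes "1 / R \<le> 10800 * \<bar>h\<bar>" "0 < R" "R / 8 \<le> z"
  shows "inverse (ennreal \<bar>h\<bar>) \<le> ennreal 86400 * ennreal z"
proof -
  have "0 < 1 / R" using assms by simp
  then have h: "0 < \<bar>h\<bar>" using assms(1) by linarith
  then have "1 / \<bar>h\<bar> \<le> 10800 * R" using assms by (simp add: field_simps)
  also have "\<dots> \<le> 86400 * z" using assms by simp
  finally have "ennreal (1 / \<bar>h\<bar>) \<le> ennreal (86400 * z)" by (rule ennreal_leI)
  then show ?thesis using h assms by (simp add: inverse_ennreal inverse_eq_divide ennreal_mult)
qed

text \<open>The variable z treats the three parameters at once. If the best fit is a line, the
  right-hand side is infinite and nothing has to be estimated.\<close>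

lemma best_fit_params_bound:
  assumes n: "3 \<le> n" and best: "best_fit_params n x y a b R"
    and cov: "scov n x y \<noteq> 0"
    and m: "9/10 \<le> tls_slope n x y" "tls_slope n x y \<le> 11/10"
    and mean: "\<bar>mean n x\<bar> \<le> 1" "\<bar>mean n y\<bar> \<le> 1"
    and res: "\<And>i. i \<in> {1..n} \<Longrightarrow> \<bar>tls_res n x y i\<bar> \<le> 1 / (10000 * (real n)\<^sup>2)"
    and pos: "\<bar>tls_pos n x y 1 + 2\<bar> \<le> 1/10" "\<bar>tls_pos n x y 2 - 2\<bar> \<le> 1/10" "\<bar>tls_pos n x y 3\<bar> \<le> 1/10"
    and z: "z \<in> {\<bar>a\<bar>, \<bar>b\<bar>, R}"
  shows "inverse (ennreal \<bar>tls_curv n x y\<bar>) \<le> ennreal 86400 * e2ennreal z"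
  using best unfolding best_fit_params_def
proof (elim disjE exE conjE)
  fix a' b' R' assume c: "best_circle n x y a' b' R'" and eq: "a = ereal a'" "b = ereal b'" "R = ereal R'"
  note B = best_circle_bound[OF n c cov m mean res pos]
  have R: "0 < R'" using c by (simp add: best_circle_def)
  obtain z' where "z = ereal z'" "R' / 8 \<le> z'" using z eq B R by auto
  then show ?thesis using inverse_ennreal_le[OF B(1) R, of z'] by (simp add: ennreal.rep_eq)
next
  assume "a = \<infinity>" "b = \<infinity>" "R = \<infinity>"
  then have "z = \<infinity>" using z by auto
  then show ?thesis by (simp add: ennreal_mult_top)
qed

section \<open>Lipschitz dependence on the data\<close>

text \<open>The l1 distance of the first n data points; as other indices are ignored, it is only a
  pseudometric on functions.\<close>

definition gap :: "nat \<Rightarrow> (nat \<Rightarrow> real \<times> real) \<Rightarrow> (nat \<Rightarrow> real \<times> real) \<Rightarrow> real" where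
  "gap n D D' = (\<Sum>i=1..n. \<bar>fst (D i) - fst (D' i)\<bar> + \<bar>snd (D i) - snd (D' i)\<bar>)"

text \<open>Boundedness is included so that the class is closed under products.\<close>

definition bdd_lip :: "nat \<Rightarrow> (nat \<Rightarrow> real \<times> real) set \<Rightarrow> ((nat \<Rightarrow> real \<times> real) \<Rightarrow> real) \<Rightarrow> bool" where
  "bdd_lip n K f \<longleftrightarrow> (\<exists>C\<ge>0. \<forall>D\<in>K. \<bar>f D\<bar> \<le> C \<and> (\<forall>D'\<in>K. \<bar>f D - f D'\<bar> \<le> C * gap n D D'))"

lemma gap_nonneg: "0 \<le> gap n D D'"
  by (auto simp: gap_def intro!: sum_nonneg)

lemma bdd_lipI:
  assumes "\<And>D. D \<in> K \<Longrightarrow> \<bar>f D\<bar> \<le> C" and "\<And>D D'. D \<in> K \<Longrightarrow> D' \<in> K \<Longrightarrow> \<bar>f D - f D'\<bar> \<le> L * gap n D D'"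
  shows "bdd_lip n K f"
  unfolding bdd_lip_def
proof (intro exI[of _ "max 0 (max C L)"] conjI ballI)
  fix D assume D: "D \<in> K"
  show "\<bar>f D\<bar> \<le> max 0 (max C L)" using assms(1)[OF D] by linarith
  fix D' assume "D' \<in> K"
  then have "\<bar>f D - f D'\<bar> \<le> L * gap n D D'" using assms(2) D by blast
  also have "\<dots> \<le> max 0 (max C L) * gap n D D'" by (intro mult_right_mono gap_nonneg) auto
  finally show "\<bar>f D - f D'\<bar> \<le> max 0 (max C L) * gap n D D'" .
qed simp

lemma bdd_lipE:
  assumes "bdd_lip n K f"
  obtains C where "0 \<le> C" "\<And>D. D \<in> K \<Longrightarrow> \<bar>f D\<bar> \<le> C"
    "\<And>D D'. D \<in> K \<Longrightarrow> D' \<in> K \<Longrightarrow> \<bar>f D - f D'\<bar> \<le> C * gap n D D'"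
  using assms unfolding bdd_lip_def by blast

lemma bdd_lip_const: "bdd_lip n K (\<lambda>D. c)"
  by (rule bdd_lipI[where C="\<bar>c\<bar>" and L=0]) auto

lemma bdd_lip_add:
  assumes "bdd_lip n K f" "bdd_lip n K g"
  shows "bdd_lip n K (\<lambda>D. f D + g D)"
proof -
  from assms(1) obtain A where A: "\<And>D. D \<in> K \<Longrightarrow> \<bar>f D\<bar> \<le> A"
    "\<And>D D'. D \<in> K \<Longrightarrow> D' \<in> K \<Longrightarrow> \<bar>f D - f D'\<bar> \<le> A * gap n D D'" by (rule bdd_lipE) blast
  from assms(2) obtain B where B: "\<And>D. D \<in> K \<Longrightarrow> \<bar>g D\<bar> \<le> B"
    "\<And>D D'. D \<in> K \<Longrightarrow> D' \<in> K \<Longrightarrow> \<bar>g D - g D'\<bar> \<le> B * gap n D D'" by (rule bdd_lipE) blast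
  show ?thesis
  proof (rule bdd_lipI[where C="A+B" and L="A+B"])
    fix D assume D: "D \<in> K"
    show "\<bar>f D + g D\<bar> \<le> A + B" using A(1)[OF D] B(1)[OF D] by linarith
    fix D' assume D': "D' \<in> K"
    show "\<bar>f D + g D - (f D' + g D')\<bar> \<le> (A + B) * gap n D D'"
      using A(2)[OF D D'] B(2)[OF D D'] by (simp add: distrib_right)
  qed
qed

lemma bdd_lip_mult:
  assumes "bdd_lip n K f" "bdd_lip n K g"
  shows "bdd_lip n K (\<lambda>D. f D * g D)"
proof -
  from assms(1) obtain A where A: "0 \<le> A" "\<And>D. D \<in> K \<Longrightarrow> \<bar>f D\<bar> \<le> A"
    "\<And>D D'. D \<in> K \<Longrightarrow> D' \<in> K \<Longrightarrow> \<bar>f D - f D'\<bar> \<le> A * gap n D D'" by (rule bdd_lipE) blast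
  from assms(2) obtain B where B: "0 \<le> B" "\<And>D. D \<in> K \<Longrightarrow> \<bar>g D\<bar> \<le> B"
    "\<And>D D'. D \<in> K \<Longrightarrow> D' \<in> K \<Longrightarrow> \<bar>g D - g D'\<bar> \<le> B * gap n D D'" by (rule bdd_lipE) blast
  show ?thesis
  proof (rule bdd_lipI[where C="A*B" and L="2*A*B"])
    fix D assume D: "D \<in> K"
    show "\<bar>f D * g D\<bar> \<le> A * B" unfolding abs_mult using A B D by (intro mult_mono) auto
    fix D' assume D': "D' \<in> K"
    have "f D * g D - f D' * g D' = f D * (g D - g D') + (f D - f D') * g D'"
      by (simp add: algebra_simps)
    then have "\<bar>f D * g D - f D' * g D'\<bar> \<le> \<bar>f D\<bar> * \<bar>g D - g D'\<bar> + \<bar>f D - f D'\<bar> * \<bar>g D'\<bar>"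
      using abs_triangle_ineq[of "f D * (g D - g D')" "(f D - f D') * g D'"] by (simp add: abs_mult)
    also have "\<dots> \<le> A * (B * gap n D D') + (A * gap n D D') * B"
      using A B D D' by (intro add_mono mult_mono) (auto simp: gap_nonneg)
    finally show "\<bar>f D * g D - f D' * g D'\<bar> \<le> 2*A*B * gap n D D'" by (simp add: algebra_simps)
  qed
qed

lemma bdd_lip_diff: "bdd_lip n K f \<Longrightarrow> bdd_lip n K g \<Longrightarrow> bdd_lip n K (\<lambda>D. f D - g D)"
  using bdd_lip_add[OF _ bdd_lip_mult[OF bdd_lip_const[of n K "-1"]], of f g] by simp

lemma bdd_lip_sum:
  assumes "finite I" "\<And>i. i \<in> I \<Longrightarrow> bdd_lip n K (f i)"
  shows "bdd_lip n K (\<lambda>D. \<Sum>i\<in>I. f i D)"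
  using assms by (induction I) (auto intro: bdd_lip_const bdd_lip_add)

lemma bdd_lip_inverse:
  assumes "bdd_lip n K f" "0 < c" and c: "\<And>D. D \<in> K \<Longrightarrow> c \<le> \<bar>f D\<bar>"
  shows "bdd_lip n K (\<lambda>D. inverse (f D))"
proof -
  from assms(1) obtain A where A: "\<And>D D'. D \<in> K \<Longrightarrow> D' \<in> K \<Longrightarrow> \<bar>f D - f D'\<bar> \<le> A * gap n D D'"
    by (rule bdd_lipE) blast
  have i: "\<bar>inverse (f D)\<bar> \<le> inverse c" if "D \<in> K" for D
    using c[OF that] assms(2) by (simp add: le_imp_inverse_le)
  show ?thesis
  proof (rule bdd_lipI[OF i, where L="inverse c * A * inverse c"])
    fix D D' assume D: "D \<in> K" "D' \<in> K"
    have "f D \<noteq> 0" "f D' \<noteq> 0" using c[OF D(1)] c[OF D(2)] assms(2) by auto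
    then have "\<bar>inverse (f D) - inverse (f D')\<bar> = \<bar>inverse (f D)\<bar> * \<bar>f D - f D'\<bar> * \<bar>inverse (f D')\<bar>"
      by (simp add: inverse_diff_inverse abs_mult)
    also have "\<dots> \<le> inverse c * (A * gap n D D') * inverse c"
      using i[OF D(1)] i[OF D(2)] A[OF D] assms(2) by (intro mult_mono) auto
    finally show "\<bar>inverse (f D) - inverse (f D')\<bar> \<le> inverse c * A * inverse c * gap n D D'"
      by (simp add: mult_ac)
  qed
qed

text \<open>sqrt (1 + a^2) is the Euclidean norm of (1, a), so this is the reverse triangle
  inequality.\<close>

lemma sqrt_one_plus_square_lipschitz: "\<bar>sqrt (1 + a\<^sup>2) - sqrt (1 + b\<^sup>2)\<bar> \<le> \<bar>a - b\<bar>"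
proof -
  have "norm (norm (1::real, a) - norm (1::real, b)) \<le> norm ((1::real, a) - (1, b))"
    by (metis norm_triangle_ineq3 real_norm_def)
  then show ?thesis by (simp add: norm_Pair)
qed

lemma bdd_lip_sqrt:
  assumes "bdd_lip n K f"
  shows "bdd_lip n K (\<lambda>D. sqrt (1 + (f D)\<^sup>2))"
proof -
  from assms obtain A where A: "\<And>D. D \<in> K \<Longrightarrow> \<bar>f D\<bar> \<le> A"
    "\<And>D D'. D \<in> K \<Longrightarrow> D' \<in> K \<Longrightarrow> \<bar>f D - f D'\<bar> \<le> A * gap n D D'" by (rule bdd_lipE) blast
  show ?thesis
  proof (rule bdd_lipI[where C="1+A" and L=A])
    fix D assume D: "D \<in> K"
    have "\<bar>sqrt (1 + (f D)\<^sup>2) - sqrt (1 + 0\<^sup>2)\<bar> \<le> \<bar>f D - 0\<bar>" by (rule sqrt_one_plus_square_lipschitz)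
    then show "\<bar>sqrt (1 + (f D)\<^sup>2)\<bar> \<le> 1 + A" using A(1)[OF D] by simp
    fix D' assume D': "D' \<in> K"
    show "\<bar>sqrt (1 + (f D)\<^sup>2) - sqrt (1 + (f D')\<^sup>2)\<bar> \<le> A * gap n D D'"
      using sqrt_one_plus_square_lipschitz[of "f D" "f D'"] A(2)[OF D D'] by linarith
  qed
qed

lemma bdd_lip_coord:
  assumes i: "i \<in> {1..n}" and K: "\<And>D. D \<in> K \<Longrightarrow> \<bar>fst (D i)\<bar> \<le> 2 \<and> \<bar>snd (D i)\<bar> \<le> 2"
  shows "bdd_lip n K (\<lambda>D. fst (D i))" "bdd_lip n K (\<lambda>D. snd (D i))"
proof -
  have *: "\<bar>fst (D i) - fst (D' i)\<bar> + \<bar>snd (D i) - snd (D' i)\<bar> \<le> gap n D D'" for D D'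
    unfolding gap_def by (rule member_le_sum[OF i, of "\<lambda>i. \<bar>fst (D i) - fst (D' i)\<bar> + \<bar>snd (D i) - snd (D' i)\<bar>"]) auto
  show "bdd_lip n K (\<lambda>D. fst (D i))"
  proof (rule bdd_lipI[where C=2 and L=1])
    show "\<bar>fst (D i) - fst (D' i)\<bar> \<le> 1 * gap n D D'" for D D' using *[of D D'] by simp
  qed (use K in auto)
  show "bdd_lip n K (\<lambda>D. snd (D i))"
  proof (rule bdd_lipI[where C=2 and L=1])
    show "\<bar>snd (D i) - snd (D' i)\<bar> \<le> 1 * gap n D D'" for D D' using *[of D D'] by simp
  qed (use K in auto)
qed

lemma bdd_lip_mean:
  assumes "\<And>i. i \<in> {1..n} \<Longrightarrow> bdd_lip n K (\<lambda>D. f D i)"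
  shows "bdd_lip n K (\<lambda>D. mean n (f D))"
  unfolding mean_def divide_inverse
  by (intro bdd_lip_mult bdd_lip_sum bdd_lip_const assms) auto

lemma bdd_lip_scov:
  assumes "\<And>i. i \<in> {1..n} \<Longrightarrow> bdd_lip n K (\<lambda>D. f D i)" "\<And>i. i \<in> {1..n} \<Longrightarrow> bdd_lip n K (\<lambda>D. g D i)"
  shows "bdd_lip n K (\<lambda>D. scov n (f D) (g D))"
  unfolding scov_def
  by (intro bdd_lip_mult bdd_lip_sum bdd_lip_diff bdd_lip_mean assms) auto

section \<open>Regularity of the total least squares quantities\<close>

abbreviation xs :: "(nat \<Rightarrow> real \<times> real) \<Rightarrow> nat \<Rightarrow> real" where "xs D \<equiv> \<lambda>i. fst (D i)"
abbreviation ys :: "(nat \<Rightarrow> real \<times> real) \<Rightarrow> nat \<Rightarrow> real" where "ys D \<equiv> \<lambda>i. snd (D i)"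

definition bounded_data :: "nat \<Rightarrow> (nat \<Rightarrow> real \<times> real) set" where
  "bounded_data n = {D. \<forall>i\<in>{1..n}. \<bar>fst (D i)\<bar> \<le> 2 \<and> \<bar>snd (D i)\<bar> \<le> 2}"

text \<open>The lower bound keeps the denominator in the slope formula away from 0; the reference
  data used later have covariance 2.\<close>

definition correlated_data :: "nat \<Rightarrow> (nat \<Rightarrow> real \<times> real) set" where
  "correlated_data n = {D \<in> bounded_data n. 1 \<le> scov n (xs D) (ys D)}"

lemma bdd_lip_data:
  assumes i: "i \<in> {1..n}" and K: "K \<subseteq> bounded_data n"
  shows "bdd_lip n K (\<lambda>D. fst (D i))" "bdd_lip n K (\<lambda>D. snd (D i))"
  by (rule bdd_lip_coord[OF i]; use i K in \<open>auto simp: bounded_data_def\<close>)+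

text \<open>All these quantities arise from the coordinates by sums, products, one square root of
  the form sqrt (1 + r^2) and one inverse, that of twice the covariance.\<close>

lemma bdd_lip_tls:
  fixes n :: nat
  defines "K \<equiv> correlated_data n"
  shows "bdd_lip n K (\<lambda>D. tls_slope n (xs D) (ys D))"
    and "i \<in> {1..n} \<Longrightarrow> bdd_lip n K (\<lambda>D. tls_res n (xs D) (ys D) i)"
    and "i \<in> {1..n} \<Longrightarrow> bdd_lip n K (\<lambda>D. tls_pos n (xs D) (ys D) i)"
    and "bdd_lip n K (\<lambda>D. tls_curv n (xs D) (ys D))"
proof -
  have sub: "K \<subseteq> bounded_data n" by (auto simp: K_def correlated_data_def)
  note coord = bdd_lip_data[OF _ sub]
  have inv: "bdd_lip n K (\<lambda>D. inverse (2 * scov n (xs D) (ys D)))"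
  proof (rule bdd_lip_inverse[where c=1])
    show "bdd_lip n K (\<lambda>D. 2 * scov n (xs D) (ys D))"
      by (intro bdd_lip_mult bdd_lip_const bdd_lip_scov coord)
  qed (auto simp: K_def correlated_data_def)
  show slope: "bdd_lip n K (\<lambda>D. tls_slope n (xs D) (ys D))"
    unfolding tls_slope_def Let_def divide_inverse
    by (intro bdd_lip_add bdd_lip_sqrt bdd_lip_mult bdd_lip_diff bdd_lip_scov coord inv)
  show res: "bdd_lip n K (\<lambda>D. tls_res n (xs D) (ys D) i)" if "i \<in> {1..n}" for i
    unfolding tls_res_def by (intro bdd_lip_mult bdd_lip_diff bdd_lip_mean coord slope that)
  show pos: "bdd_lip n K (\<lambda>D. tls_pos n (xs D) (ys D) i)" if "i \<in> {1..n}" for i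
    unfolding tls_pos_def by (intro bdd_lip_add bdd_lip_mult bdd_lip_diff bdd_lip_mean coord slope that)
  show "bdd_lip n K (\<lambda>D. tls_curv n (xs D) (ys D))"
    unfolding tls_curv_def power2_eq_square by (intro bdd_lip_sum bdd_lip_mult res pos) auto
qed

section \<open>A collinear reference configuration and its neighbourhood\<close>

definition base_data :: "real \<Rightarrow> nat \<Rightarrow> real \<times> real" where
  "base_data s i = (if i = 1 then (-1, -1 + s) else if i = 2 then (1, 1) else (0, 0))"

lemma sum_first_two:
  fixes f :: "nat \<Rightarrow> real"
  assumes "3 \<le> n" "\<And>i. i \<noteq> 1 \<Longrightarrow> i \<noteq> 2 \<Longrightarrow> f i = 0"
  shows "(\<Sum>i=1..n. f i) = f 1 + f 2"
proof -
  have "(\<Sum>i=1..n. f i) = (\<Sum>i\<in>{1,2}. f i)"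
    by (rule sum.mono_neutral_right) (use assms in auto)
  then show ?thesis by simp
qed

lemma mean_base:
  assumes "3 \<le> n"
  shows "mean n (xs (base_data s)) = 0" "mean n (ys (base_data s)) = s / real n"
proof -
  show "mean n (xs (base_data s)) = 0" "mean n (ys (base_data s)) = s / real n"
    unfolding mean_def by (subst sum_first_two[OF assms]; simp add: base_data_def)+
qed

text \<open>For s = 0 all points lie on the diagonal, so the three covariances coincide, r = 0 and
  the slope is 1.\<close>

lemma tls_base_0:
  assumes n: "3 \<le> n"
  shows "scov n (xs (base_data 0)) (ys (base_data 0)) = 2" "tls_slope n (xs (base_data 0)) (ys (base_data 0)) = 1"
    "tls_res n (xs (base_data 0)) (ys (base_data 0)) i = 0"
    "tls_pos n (xs (base_data 0)) (ys (base_data 0)) i = 2 * fst (base_data 0 i)"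
proof -
  have eq: "snd (base_data 0 i) = fst (base_data 0 i)" for i unfolding base_data_def by simp
  show "scov n (xs (base_data 0)) (ys (base_data 0)) = 2"
    unfolding eq scov_def mean_base[OF n] by (subst sum_first_two[OF n]) (auto simp: base_data_def)
  show m: "tls_slope n (xs (base_data 0)) (ys (base_data 0)) = 1" unfolding eq tls_slope_def by simp
  show "tls_res n (xs (base_data 0)) (ys (base_data 0)) i = 0"
    unfolding tls_res_def m unfolding eq by simp
  show "tls_pos n (xs (base_data 0)) (ys (base_data 0)) i = 2 * fst (base_data 0 i)"
    unfolding tls_pos_def m unfolding eq mean_base[OF n] by simp
qed

text \<open>All but two of the points sit at the origin, so \<open>p = x + m y\<close> vanishes there and the two
  relations \<open>\<Sum>e\<^sub>i = 0\<close> and \<open>\<Sum>p\<^sub>i e\<^sub>i = 0\<close> determine \<open>\<Sum>p\<^sub>i\<^sup>2 e\<^sub>i\<close> without computing the slope \<open>m\<close>.\<close>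

lemma tls_curv_base:
  assumes n: "3 \<le> n" and cov: "scov n (xs (base_data s)) (ys (base_data s)) \<noteq> 0"
  defines "m \<equiv> tls_slope n (xs (base_data s)) (ys (base_data s))"
  shows "tls_curv n (xs (base_data s)) (ys (base_data s)) = s * (1 - 2 / real n) * (1 + m * (1 - s)) * (1 + m)"
proof -
  define e where "e = tls_res n (xs (base_data s)) (ys (base_data s))"
  define t where "t = tls_pos n (xs (base_data s)) (ys (base_data s))"
  define p where "p i = fst (base_data s i) + m * snd (base_data s i)" for i
  define c where "c = m * (s / real n)"
  \<comment> \<open>Passing from t to p is a shift by a constant. It leaves the first and second
    moments against e unchanged, because the lower moments vanish.\<close>
  have pt: "p i = t i + c" for i
    unfolding t_def tls_pos_def p_def c_def m_def[symmetric] mean_base[OF n] by (simp add: algebra_simps)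
  have 0: "(\<Sum>i=1..n. e i) = 0" "(\<Sum>i=1..n. t i * e i) = 0"
    unfolding e_def t_def by (rule sum_tls_res, rule sum_tls_pos_res[OF cov])
  have p0: "p i = 0" if "i \<noteq> 1" "i \<noteq> 2" for i using that by (simp add: p_def base_data_def)
  have "(\<Sum>i=1..n. p i * e i) = (\<Sum>i=1..n. t i * e i) + c * (\<Sum>i=1..n. e i)"
    unfolding pt sum_distrib_left by (simp add: sum.distrib algebra_simps)
  then have 1: "p 1 * e 1 + p 2 * e 2 = 0"
    using 0 sum_first_two[OF n, of "\<lambda>i. p i * e i"] p0 by simp
  have "(\<Sum>i=1..n. (p i)\<^sup>2 * e i) = (\<Sum>i=1..n. (t i)\<^sup>2 * e i) + 2 * c * (\<Sum>i=1..n. t i * e i)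
      + c\<^sup>2 * (\<Sum>i=1..n. e i)"
    unfolding pt sum_distrib_left by (simp add: sum.distrib algebra_simps power2_eq_square)
  then have 2: "(\<Sum>i=1..n. (t i)\<^sup>2 * e i) = (p 1)\<^sup>2 * e 1 + (p 2)\<^sup>2 * e 2"
    using 0 sum_first_two[OF n, of "\<lambda>i. (p i)\<^sup>2 * e i"] p0 by simp
  \<comment> \<open>The slope drops out because the abscissas -1 and 1 cancel.\<close>
  have "e 1 + e 2 = s * (1 - 2 / real n)"
    unfolding e_def tls_res_def m_def[symmetric] mean_base[OF n] by (simp add: base_data_def algebra_simps)
  then have "- p 1 * ((e 1 + e 2) * p 2) = s * (1 - 2 / real n) * (- p 1) * p 2" by simp
  moreover have "(p 1)\<^sup>2 * e 1 + (p 2)\<^sup>2 * e 2 = - p 1 * ((e 1 + e 2) * p 2)"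
    using 1 by algebra
  moreover have "- p 1 = 1 + m * (1 - s)" "p 2 = 1 + m" by (simp_all add: p_def base_data_def algebra_simps)
  ultimately show ?thesis using 2 unfolding tls_curv_def e_def t_def by metis
qed

text \<open>Bundles the conditions on the data in \<open>best_fit_params_bound\<close>.\<close>

definition nearly_collinear :: "nat \<Rightarrow> (nat \<Rightarrow> real) \<Rightarrow> (nat \<Rightarrow> real) \<Rightarrow> bool" where
  "nearly_collinear n x y \<longleftrightarrow> scov n x y \<noteq> 0 \<and> tls_slope n x y \<in> {9/10..11/10} \<and>
     \<bar>mean n x\<bar> \<le> 1 \<and> \<bar>mean n y\<bar> \<le> 1 \<and>
     (\<forall>i\<in>{1..n}. \<bar>tls_res n x y i\<bar> \<le> 1 / (10000 * (real n)\<^sup>2)) \<and>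
     \<bar>tls_pos n x y 1 + 2\<bar> \<le> 1/10 \<and> \<bar>tls_pos n x y 2 - 2\<bar> \<le> 1/10 \<and> \<bar>tls_pos n x y 3\<bar> \<le> 1/10"

text \<open>As a filter, finitely many closeness conditions can be combined without tracking radii;
  a single radius is extracted at the end.\<close>

definition near_base :: "nat \<Rightarrow> (nat \<Rightarrow> real \<times> real) filter" where
  "near_base n = filtercomap (\<lambda>D. gap n D (base_data 0)) (nhds 0)"

text \<open>The second coordinate of the first point has its own half-width s: the curvature term
  must change sign along that direction, while all other coordinates vary by an r chosen later in
  terms of s.\<close>

definition data_box :: "nat \<Rightarrow> real \<Rightarrow> real \<Rightarrow> (nat \<Rightarrow> real \<times> real) set" where
  "data_box n r s = {D. \<forall>i\<in>{1..n}. \<bar>fst (D i) - fst (base_data 0 i)\<bar> \<le> r \<and>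
      \<bar>snd (D i) - snd (base_data 0 i)\<bar> \<le> (if i = 1 then s else r)}"

lemma eventually_near_base:
  "eventually P (near_base n) \<longleftrightarrow> (\<exists>R>0. \<forall>D. gap n D (base_data 0) < R \<longrightarrow> P D)"
proof
  assume "eventually P (near_base n)"
  then obtain R where "0 < R" "\<And>D. dist (gap n D (base_data 0)) 0 < R \<Longrightarrow> P D"
    unfolding near_base_def eventually_filtercomap eventually_nhds_metric by blast
  then show "\<exists>R>0. \<forall>D. gap n D (base_data 0) < R \<longrightarrow> P D" by (auto simp: gap_nonneg)
next
  assume "\<exists>R>0. \<forall>D. gap n D (base_data 0) < R \<longrightarrow> P D"
  then obtain R where R: "0 < R" "\<And>D. gap n D (base_data 0) < R \<Longrightarrow> P D" by blast
  have "eventually (\<lambda>t. t < R) (nhds 0)" by (rule order_tendstoD[OF filterlim_ident R(1)])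
  then show "eventually P (near_base n)"
    unfolding near_base_def eventually_filtercomap using R(2) by blast
qed

lemma bdd_lip_eventually:
  assumes f: "bdd_lip n K f" and K: "base_data 0 \<in> K" "eventually (\<lambda>D. D \<in> K) (near_base n)" and e: "0 < e"
  shows "eventually (\<lambda>D. \<bar>f D - f (base_data 0)\<bar> < e) (near_base n)"
proof -
  from f obtain C where C: "0 \<le> C" "\<And>D D'. D \<in> K \<Longrightarrow> D' \<in> K \<Longrightarrow> \<bar>f D - f D'\<bar> \<le> C * gap n D D'"
    by (rule bdd_lipE) blast
  \<comment> \<open>C + 1 instead of C avoids a division by zero.\<close>
  have "eventually (\<lambda>D. gap n D (base_data 0) < e / (C + 1)) (near_base n)"
    unfolding eventually_near_base using C e by (intro exI[of _ "e / (C + 1)"]) auto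
  with K(2) show ?thesis
  proof eventually_elim
    case (elim D)
    have "C * gap n D (base_data 0) \<le> (C + 1) * gap n D (base_data 0)" by (intro mult_right_mono gap_nonneg) auto
    also have "\<dots> < e" using elim(2) C by (simp add: field_simps)
    finally show ?case using C(2)[OF elim(1) K(1)] by linarith
  qed
qed

text \<open>Two stages: data near the reference are bounded, and on bounded data the covariance is
  Lipschitz, hence it stays close to its reference value 2.\<close>

lemma correlated_near_base:
  assumes n: "3 \<le> n"
  shows "base_data 0 \<in> correlated_data n" "eventually (\<lambda>D. D \<in> correlated_data n) (near_base n)"
proof -
  have b: "base_data 0 \<in> bounded_data n" by (auto simp: bounded_data_def base_data_def)
  then show "base_data 0 \<in> correlated_data n" using tls_base_0(1)[OF n] by (simp add: correlated_data_def)
  have "eventually (\<lambda>D. gap n D (base_data 0) < 1) (near_base n)"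
    unfolding eventually_near_base by (intro exI[of _ 1]) auto
  then have bd: "eventually (\<lambda>D. D \<in> bounded_data n) (near_base n)"
  proof eventually_elim
    case (elim D)
    show ?case unfolding bounded_data_def
    proof (intro CollectI ballI)
      fix i assume i: "i \<in> {1..n}"
      have "\<bar>fst (D i) - fst (base_data 0 i)\<bar> + \<bar>snd (D i) - snd (base_data 0 i)\<bar> \<le> gap n D (base_data 0)"
        unfolding gap_def
        by (rule member_le_sum[OF i, of "\<lambda>i. \<bar>fst (D i) - fst (base_data 0 i)\<bar> + \<bar>snd (D i) - snd (base_data 0 i)\<bar>"]) auto
      moreover have "\<bar>fst (base_data 0 i)\<bar> \<le> 1" "\<bar>snd (base_data 0 i)\<bar> \<le> 1" by (auto simp: base_data_def)
      ultimately show "\<bar>fst (D i)\<bar> \<le> 2 \<and> \<bar>snd (D i)\<bar> \<le> 2" using elim by linarith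
    qed
  qed
  have "bdd_lip n (bounded_data n) (\<lambda>D. scov n (xs D) (ys D))"
    by (intro bdd_lip_scov bdd_lip_data) auto
  from bdd_lip_eventually[OF this b bd, of 1]
  have "eventually (\<lambda>D. \<bar>scov n (xs D) (ys D) - 2\<bar> < 1) (near_base n)"
    using tls_base_0(1)[OF n] by simp
  with bd show "eventually (\<lambda>D. D \<in> correlated_data n) (near_base n)"
  proof eventually_elim
    case (elim D)
    then show ?case unfolding correlated_data_def by (auto simp: abs_less_iff)
  qed
qed

text \<open>At the reference data every condition holds with room to spare: the residuals are 0, the
  slope is 1 and the three positions are -2, 2 and 0.\<close>

lemma nearly_collinear_near_base:
  assumes n: "3 \<le> n"
  shows "eventually (\<lambda>D. nearly_collinear n (xs D) (ys D)) (near_base n)"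
proof -
  note K = correlated_near_base[OF n]
  note ev = bdd_lip_eventually[OF _ K]
  note co = bdd_lip_data[of _ n "correlated_data n"]
  have sub: "correlated_data n \<subseteq> bounded_data n" by (auto simp: correlated_data_def)
  have mean: "bdd_lip n (correlated_data n) (\<lambda>D. mean n (xs D))"
    "bdd_lip n (correlated_data n) (\<lambda>D. mean n (ys D))"
    by (intro bdd_lip_mean co sub; assumption)+
  have I: "1 \<in> {1..n}" "2 \<in> {1..n}" "3 \<in> {1..n}" using n by auto
  have "0 < 1 / (10000 * (real n)\<^sup>2)" using n by simp
  from ev[OF bdd_lip_tls(2) this]
  have "eventually (\<lambda>D. \<forall>i\<in>{1..n}. \<bar>tls_res n (xs D) (ys D) i\<bar> < 1 / (10000 * (real n)\<^sup>2)) (near_base n)"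
    unfolding tls_base_0(3)[OF n] by (intro eventually_ball_finite) auto
  moreover have "eventually (\<lambda>D. \<bar>tls_slope n (xs D) (ys D) - 1\<bar> < 1/10) (near_base n)"
    using ev[OF bdd_lip_tls(1), of "1/10"] unfolding tls_base_0(2)[OF n] by simp
  moreover have "eventually (\<lambda>D. \<bar>mean n (xs D)\<bar> < 1) (near_base n)"
    "eventually (\<lambda>D. \<bar>mean n (ys D)\<bar> < 1) (near_base n)"
    using ev[OF mean(1), of 1] ev[OF mean(2), of 1] unfolding mean_base[OF n] by simp_all
  moreover have "eventually (\<lambda>D. \<bar>tls_pos n (xs D) (ys D) 1 + 2\<bar> < 1/10) (near_base n)"
    "eventually (\<lambda>D. \<bar>tls_pos n (xs D) (ys D) 2 - 2\<bar> < 1/10) (near_base n)"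
    "eventually (\<lambda>D. \<bar>tls_pos n (xs D) (ys D) 3\<bar> < 1/10) (near_base n)"
    using ev[OF bdd_lip_tls(3)[OF I(1)], of "1/10"] ev[OF bdd_lip_tls(3)[OF I(2)], of "1/10"]
      ev[OF bdd_lip_tls(3)[OF I(3)], of "1/10"]
    unfolding tls_base_0(4)[OF n] by (simp_all add: base_data_def)
  ultimately show ?thesis using K(2)
  proof eventually_elim
    case (elim D)
    have "scov n (xs D) (ys D) \<noteq> 0" using elim by (auto simp: correlated_data_def)
    moreover have "tls_slope n (xs D) (ys D) \<in> {9/10..11/10}" using elim(2)
      unfolding atLeastAtMost_iff by linarith
    ultimately show ?case unfolding nearly_collinear_def using elim by (auto intro: less_imp_le)
  qed
qed

text \<open>The second estimate is free of s, since D and \<open>base_data t\<close> agree in the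
  second coordinate of the first point.\<close>

lemma gap_data_box:
  assumes n: "3 \<le> n" and D: "D \<in> data_box n r s" and "0 \<le> r" "0 \<le> s"
  shows "gap n D (base_data 0) \<le> 2 * real n * r + s"
    and "snd (D 1) = -1 + t \<Longrightarrow> gap n D (base_data t) \<le> 2 * real n * r"
proof -
  have D': "\<bar>fst (D i) - fst (base_data 0 i)\<bar> \<le> r"
    "\<bar>snd (D i) - snd (base_data 0 i)\<bar> \<le> (if i = 1 then s else r)" if "i \<in> {1..n}" for i
    using D that unfolding data_box_def by blast+
  have "gap n D (base_data 0) \<le> (\<Sum>i=1..n. 2 * r + (if i = 1 then s else 0))"
    unfolding gap_def
  proof (rule sum_mono)
    fix i assume i: "i \<in> {1..n}"
    show "\<bar>fst (D i) - fst (base_data 0 i)\<bar> + \<bar>snd (D i) - snd (base_data 0 i)\<bar> \<le> 2 * r + (if i = 1 then s else 0)"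
      using D'[OF i] assms(3) by (cases "i = 1") auto
  qed
  also have "\<dots> = 2 * real n * r + s" using n by (simp add: sum.distrib)
  finally show "gap n D (base_data 0) \<le> 2 * real n * r + s" .
  assume t: "snd (D 1) = -1 + t"
  have "gap n D (base_data t) \<le> (\<Sum>i=1..n. 2 * r)"
    unfolding gap_def
  proof (rule sum_mono)
    fix i assume i: "i \<in> {1..n}"
    show "\<bar>fst (D i) - fst (base_data t i)\<bar> + \<bar>snd (D i) - snd (base_data t i)\<bar> \<le> 2 * r"
    proof (cases "i = 1")
      case True
      then show ?thesis using D'(1)[OF i] t assms(3) by (simp add: base_data_def)
    next
      case False
      then have "base_data t i = base_data 0 i" by (simp add: base_data_def)
      then show ?thesis using D'[OF i] False by simp
    qed
  qed
  then show "gap n D (base_data t) \<le> 2 * real n * r" by simp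
qed

text \<open>First s is fixed, so that the curvature term has opposite signs at
  \<open>base_data s\<close> and \<open>base_data (-s)\<close>. Then r is taken so small that, by
  the Lipschitz bound, these signs persist on the two opposite faces of the box.\<close>

lemma collinear_data_box:
  assumes n: "3 \<le> n"
  obtains r s L where "0 < r" "0 < s" "0 \<le> L"
    and "\<And>D. D \<in> data_box n r s \<Longrightarrow> nearly_collinear n (xs D) (ys D)"
    and "\<And>D D'. D \<in> data_box n r s \<Longrightarrow> D' \<in> data_box n r s \<Longrightarrow>
           \<bar>tls_curv n (xs D) (ys D) - tls_curv n (xs D') (ys D')\<bar> \<le> L * gap n D D'"
    and "\<And>D. D \<in> data_box n r s \<Longrightarrow> snd (D 1) = -1 + s \<Longrightarrow> 0 < tls_curv n (xs D) (ys D)"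
    and "\<And>D. D \<in> data_box n r s \<Longrightarrow> snd (D 1) = -1 + - s \<Longrightarrow> tls_curv n (xs D) (ys D) < 0"
proof -
  define h where "h D = tls_curv n (xs D) (ys D)" for D
  from eventually_conj[OF correlated_near_base(2)[OF n] nearly_collinear_near_base[OF n]]
  obtain R where R: "0 < R" "\<And>D. gap n D (base_data 0) < R \<Longrightarrow> D \<in> correlated_data n"
    "\<And>D. gap n D (base_data 0) < R \<Longrightarrow> nearly_collinear n (xs D) (ys D)"
    unfolding eventually_near_base by blast
  from bdd_lip_tls(4)[of n] obtain L where L: "0 \<le> L"
    "\<And>D D'. D \<in> correlated_data n \<Longrightarrow> D' \<in> correlated_data n \<Longrightarrow> \<bar>h D - h D'\<bar> \<le> L * gap n D D'"
    unfolding h_def by (rule bdd_lipE) blast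
  \<comment> \<open>R / 2 leaves room for r within the radius R, and 1/2 keeps 1 - t positive for
    |t| <= s.\<close>
  define s where "s = min (R / 2) (1 / 2)"
  have s: "0 < s" "s \<le> R / 2" "s \<le> 1/2" using R(1) by (auto simp: s_def)
  have gb: "gap n (base_data t) (base_data 0) < R" if "\<bar>t\<bar> \<le> s" for t
  proof -
    have "base_data t \<in> data_box n 0 s" using that by (auto simp: data_box_def base_data_def)
    then have "gap n (base_data t) (base_data 0) \<le> s" using gap_data_box(1)[OF n, of "base_data t" 0 s] s by simp
    then show ?thesis using s R by linarith
  qed
  \<comment> \<open>The closed formula is t times a factor that is positive because n >= 3, t <= 1/2
    and the slope is positive.\<close>
  have val: "\<exists>c>0. h (base_data t) = t * c" if t: "\<bar>t\<bar> \<le> s" for t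
  proof -
    have g: "nearly_collinear n (xs (base_data t)) (ys (base_data t))" using R(3) gb[OF t] .
    let ?m = "tls_slope n (xs (base_data t)) (ys (base_data t))"
    have "0 \<le> ?m * (1 - t)" using g t s by (intro mult_nonneg_nonneg) (auto simp: nearly_collinear_def)
    moreover have "0 < 1 - 2 / real n" using n by simp
    moreover have "0 < 1 + ?m" using g by (auto simp: nearly_collinear_def)
    ultimately have "0 < (1 - 2 / real n) * (1 + ?m * (1 - t)) * (1 + ?m)" by (intro mult_pos_pos) auto
    moreover have "h (base_data t) = t * ((1 - 2 / real n) * (1 + ?m * (1 - t)) * (1 + ?m))"
      unfolding h_def using tls_curv_base[OF n, of t] g by (simp add: nearly_collinear_def mult.assoc)
    ultimately show ?thesis by blast
  qed
  obtain c1 c2 where c: "0 < c1" "h (base_data s) = s * c1" "0 < c2" "h (base_data (-s)) = (-s) * c2"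
    using val[of s] val[of "-s"] s by auto
  define d where "d = min (s * c1) (s * c2)"
  have d: "0 < d" "d \<le> h (base_data s)" "h (base_data (-s)) \<le> - d" using s c by (auto simp: d_def)
  \<comment> \<open>The first bound keeps the box inside the radius R; the second keeps L * (2 * n *
    r), the possible change of h, below d.\<close>
  define r where "r = min (R / (5 * real n)) (d / (4 * real n * (L + 1)))"
  have r: "0 < r" using R d L n by (auto simp: r_def)
  have r1: "2 * real n * r < R / 2"
  proof -
    have "r \<le> R / (5 * real n)" by (simp add: r_def)
    then have "r * (5 * real n) \<le> R" using n by (simp add: field_simps)
    then have "5 * (real n * r) \<le> R" by (simp add: mult_ac)
    then show ?thesis using R(1) unfolding mult.assoc by linarith
  qed
  have r2: "L * (2 * real n * r) < d"
  proof -
    have "r \<le> d / (4 * real n * (L + 1))" by (simp add: r_def)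
    then have "r * (4 * real n * (L + 1)) \<le> d" using n L by (simp add: pos_le_divide_eq)
    then have "2 * ((L + 1) * (2 * real n * r)) \<le> d" by (simp add: algebra_simps)
    moreover have "L * (2 * real n * r) \<le> (L + 1) * (2 * real n * r)"
      using r by (intro mult_right_mono) auto
    ultimately show ?thesis using d by linarith
  qed
  have bR: "gap n D (base_data 0) < R" if "D \<in> data_box n r s" for D
    using gap_data_box(1)[OF n that] r s r1 by linarith
  have close: "\<bar>h D - h (base_data t)\<bar> < d" if D: "D \<in> data_box n r s" "snd (D 1) = -1 + t" "\<bar>t\<bar> \<le> s" for D t
  proof -
    have "L * gap n D (base_data t) \<le> L * (2 * real n * r)"
      using gap_data_box(2)[OF n D(1) _ _ D(2)] r s L by (intro mult_left_mono) auto
    then show ?thesis using L(2)[OF R(2)[OF bR[OF D(1)]] R(2)[OF gb[OF D(3)]]] r2 by linarith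
  qed
  show thesis
  proof (rule that[OF r s(1) L(1)])
    fix D assume D: "D \<in> data_box n r s"
    show "nearly_collinear n (xs D) (ys D)" using R(3) bR[OF D] .
    { fix D' assume "D' \<in> data_box n r s"
      then show "\<bar>tls_curv n (xs D) (ys D) - tls_curv n (xs D') (ys D')\<bar> \<le> L * gap n D D'"
        using L(2)[OF R(2)[OF bR[OF D]] R(2)[OF bR]] unfolding h_def by blast }
    { assume "snd (D 1) = -1 + s"
      from close[OF D this] show "0 < tls_curv n (xs D) (ys D)" using d s unfolding h_def by linarith }
    { assume "snd (D 1) = -1 + - s"
      from close[OF D this] show "tls_curv n (xs D) (ys D) < 0" using d s unfolding h_def by linarith }
  qed
qed

section \<open>Divergence of a reciprocal at a zero\<close>

lemma inverse_antimono_ennreal: "a \<le> b \<Longrightarrow> inverse b \<le> inverse (a :: ennreal)"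
  including ennreal.lifting by transfer (rule ereal_inverse_antimono)

text \<open>By the intermediate value theorem h has a zero z, and the Lipschitz bound gives |h s| <=
  C * |s - z|. The integral thus dominates a logarithmically divergent one to the right of
  z.\<close>

lemma nn_integral_inverse_zero:
  fixes h :: "real \<Rightarrow> real"
  assumes "lo < hi" and lip: "\<And>a b. a \<in> {lo..hi} \<Longrightarrow> b \<in> {lo..hi} \<Longrightarrow> \<bar>h a - h b\<bar> \<le> L * \<bar>a - b\<bar>"
    and "h lo < 0" "0 < h hi"
  shows "(\<integral>\<^sup>+s. inverse (ennreal \<bar>h s\<bar>) * indicator {lo..hi} s \<partial>lborel) = \<infinity>"
proof -
  define C where "C = max L 1"
  have C: "1 \<le> C" "L \<le> C" by (auto simp: C_def)
  have lipC: "\<bar>h a - h b\<bar> \<le> C * \<bar>a - b\<bar>" if "a \<in> {lo..hi}" "b \<in> {lo..hi}" for a b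
    using lip[OF that] mult_right_mono[OF C(2), of "\<bar>a - b\<bar>"] by linarith
  have "continuous_on {lo..hi} h"
    using lipC C by (intro lipschitz_on_continuous_on[of C] lipschitz_onI) (auto simp: dist_real_def)
  then obtain z where z: "lo \<le> z" "z \<le> hi" "h z = 0"
    using IVT'[of h lo 0 hi] assms by auto
  \<comment> \<open>Since h hi > 0, the zero is not hi and this length is positive.\<close>
  define b where "b = hi - z"
  have b: "0 < b" using z assms by (cases "z = hi") (auto simp: b_def)
  have ge: "ennreal (N / C) \<le> (\<integral>\<^sup>+s. inverse (ennreal \<bar>h s\<bar>) * indicator {lo..hi} s \<partial>lborel)" if N: "0 \<le> N" for N
  proof -
    \<comment> \<open>Chosen so that the integral of 1 / (C * (s - z)) from z + a to z + b is
      exactly N / C.\<close>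
    define a where "a = b * exp (- N)"
    have a: "0 < a" "a \<le> b" using b N by (auto simp: a_def)
    have "ennreal (ln (z + b - z) / C - ln (z + a - z) / C) =
        (\<integral>\<^sup>+s. ennreal (1 / (C * (s - z))) * indicator {z + a..z + b} s \<partial>lborel)"
    proof (rule nn_integral_FTC_Icc[symmetric, where F="\<lambda>s. ln (s - z) / C"])
      fix s assume "s \<in> {z + a..z + b}"
      then have s: "0 < s - z" using a by auto
      show "((\<lambda>s. ln (s - z) / C) has_real_derivative 1 / (C * (s - z))) (at s)"
        using s C by (auto intro!: derivative_eq_intros simp: field_simps)
      show "0 \<le> 1 / (C * (s - z))" using s C by simp
    qed (use a in auto)
    also have "\<dots> \<le> (\<integral>\<^sup>+s. inverse (ennreal \<bar>h s\<bar>) * indicator {lo..hi} s \<partial>lborel)"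
    proof (rule nn_integral_mono)
      fix s
      show "ennreal (1 / (C * (s - z))) * indicator {z + a..z + b} s \<le> inverse (ennreal \<bar>h s\<bar>) * indicator {lo..hi} s"
      proof (cases "s \<in> {z + a..z + b}")
        case True
        then have s: "0 < s - z" "s \<in> {lo..hi}" using a z by (auto simp: b_def)
        then have "\<bar>h s\<bar> \<le> C * (s - z)" using lipC[of s z] z by auto
        then have "inverse (ennreal (C * (s - z))) \<le> inverse (ennreal \<bar>h s\<bar>)"
          by (intro inverse_antimono_ennreal ennreal_leI)
        then show ?thesis using True s C by (simp add: inverse_ennreal inverse_eq_divide)
      qed simp
    qed
    finally show ?thesis using b by (simp add: a_def ln_mult diff_divide_distrib add_divide_distrib)
  qed
  show ?thesis
  proof (rule ccontr)
    assume "\<not> ?thesis"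
    then obtain q where q: "0 \<le> q" "(\<integral>\<^sup>+s. inverse (ennreal \<bar>h s\<bar>) * indicator {lo..hi} s \<partial>lborel) = ennreal q"
      by (cases "\<integral>\<^sup>+s. inverse (ennreal \<bar>h s\<bar>) * indicator {lo..hi} s \<partial>lborel" rule: ennreal_cases) auto
    have "ennreal (C * (q + 1) / C) \<le> ennreal q" unfolding q(2)[symmetric] using q C by (intro ge) auto
    then show False using q C by simp
  qed
qed

section \<open>Integration over the error distribution\<close>

text \<open>In \<open>ennreal\<close> the inverse of \<open>0\<close> is \<open>\<infinity>\<close>, as it should be here: the best fit is then a line.\<close>

definition singular :: "nat \<Rightarrow> real \<Rightarrow> real \<Rightarrow> (nat \<Rightarrow> real \<times> real) \<Rightarrow> ennreal" where
  "singular n r s D = indicator (data_box n r s) D * inverse (ennreal \<bar>tls_curv n (xs D) (ys D)\<bar>)"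

lemma tls_curv_cong:
  assumes x: "\<And>i. i \<in> {1..n} \<Longrightarrow> x i = x' i" and y: "\<And>i. i \<in> {1..n} \<Longrightarrow> y i = y' i"
  shows "tls_curv n x y = tls_curv n x' y'"
proof -
  have mean: "mean n f = mean n g" if "\<And>i. i \<in> {1..n} \<Longrightarrow> f i = g i" for f g
    unfolding mean_def by (rule arg_cong[of _ _ "\<lambda>z. z / real n"], rule sum.cong) (simp_all add: that)
  have scov: "scov n f g = scov n f' g'"
    if f: "\<And>i. i \<in> {1..n} \<Longrightarrow> f i = f' i" and g: "\<And>i. i \<in> {1..n} \<Longrightarrow> g i = g' i" for f g f' g'
  proof -
    have "mean n f = mean n f'" "mean n g = mean n g'" by (rule mean, erule f, rule mean, erule g)
    then show ?thesis unfolding scov_def by (intro sum.cong) (simp_all add: f g)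
  qed
  have "mean n x = mean n x'" "mean n y = mean n y'" by (rule mean, erule x, rule mean, erule y)
  moreover have "scov n x x = scov n x' x'" "scov n y y = scov n y' y'" "scov n x y = scov n x' y'"
    by (rule scov; use x y in simp)+
  then have "tls_slope n x y = tls_slope n x' y'" unfolding tls_slope_def by simp
  ultimately show ?thesis
    unfolding tls_curv_def tls_pos_def tls_res_def by (intro sum.cong) (simp_all add: x y)
qed

text \<open>Allows the data to be replaced by functions restricted to {1..n}, as they occur in
  product spaces.\<close>

lemma singular_cong:
  assumes "\<And>i. i \<in> {1..n} \<Longrightarrow> D i = D' i"
  shows "singular n r s D = singular n r s D'"
proof -
  have "tls_curv n (xs D) (ys D) = tls_curv n (xs D') (ys D')"
    by (rule tls_curv_cong) (simp_all add: assms)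
  moreover have "D \<in> data_box n r s \<longleftrightarrow> D' \<in> data_box n r s" using assms by (auto simp: data_box_def)
  ultimately show ?thesis by (simp add: singular_def indicator_def)
qed

lemma measurable_tls_curv:
  assumes x: "\<And>i. i \<in> {1..n} \<Longrightarrow> (\<lambda>\<omega>. x \<omega> i) \<in> borel_measurable N"
    and y: "\<And>i. i \<in> {1..n} \<Longrightarrow> (\<lambda>\<omega>. y \<omega> i) \<in> borel_measurable N"
  shows "(\<lambda>\<omega>. tls_curv n (x \<omega>) (y \<omega>)) \<in> borel_measurable N"
proof -
  have mean: "(\<lambda>\<omega>. mean n (f \<omega>)) \<in> borel_measurable N"
    if "\<And>i. i \<in> {1..n} \<Longrightarrow> (\<lambda>\<omega>. f \<omega> i) \<in> borel_measurable N" for f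
    unfolding mean_def by (intro borel_measurable_divide borel_measurable_sum borel_measurable_const that)
  have scov: "(\<lambda>\<omega>. scov n (f \<omega>) (g \<omega>)) \<in> borel_measurable N"
    if "\<And>i. i \<in> {1..n} \<Longrightarrow> (\<lambda>\<omega>. f \<omega> i) \<in> borel_measurable N"
      "\<And>i. i \<in> {1..n} \<Longrightarrow> (\<lambda>\<omega>. g \<omega> i) \<in> borel_measurable N" for f g
    unfolding scov_def by (intro borel_measurable_sum borel_measurable_times borel_measurable_diff mean that)
  note [measurable] = scov[OF x x] scov[OF y y] scov[OF x y] mean[OF x] mean[OF y]
  have slope[measurable]: "(\<lambda>\<omega>. tls_slope n (x \<omega>) (y \<omega>)) \<in> borel_measurable N"
    unfolding tls_slope_def Let_def by measurable
  have "(\<lambda>\<omega>. (tls_pos n (x \<omega>) (y \<omega>) i)\<^sup>2 * tls_res n (x \<omega>) (y \<omega>) i) \<in> borel_measurable N"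
    if i: "i \<in> {1..n}" for i
  proof -
    note [measurable] = x[OF i] y[OF i]
    show ?thesis unfolding tls_pos_def tls_res_def by measurable
  qed
  then show ?thesis unfolding tls_curv_def by (rule borel_measurable_sum)
qed

lemma measurable_singular:
  fixes X :: "nat \<Rightarrow> 'w \<Rightarrow> real \<times> real"
  assumes X: "\<And>i. i \<in> {1..n} \<Longrightarrow> X i \<in> borel_measurable N"
  shows "(\<lambda>\<omega>. singular n r s (\<lambda>i. X i \<omega>)) \<in> borel_measurable N"
proof -
  have fs: "(\<lambda>\<omega>. fst (X i \<omega>)) \<in> borel_measurable N" "(\<lambda>\<omega>. snd (X i \<omega>)) \<in> borel_measurable N"
    if "i \<in> {1..n}" for i
    using X[OF that] by (auto simp: borel_prod[symmetric])
  have c[measurable]: "(\<lambda>\<omega>. tls_curv n (\<lambda>i. fst (X i \<omega>)) (\<lambda>i. snd (X i \<omega>))) \<in> borel_measurable N"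
    by (intro measurable_tls_curv fs)
  have "Measurable.pred N (\<lambda>\<omega>. (\<lambda>i. X i \<omega>) \<in> data_box n r s)"
    unfolding data_box_def mem_Collect_eq
  proof (rule pred_intros_finite(3))
    fix i assume i: "i \<in> {1..n}"
    note [measurable] = fs[OF i]
    show "Measurable.pred N (\<lambda>\<omega>. \<bar>fst (X i \<omega>) - fst (base_data 0 i)\<bar> \<le> r \<and>
       \<bar>snd (X i \<omega>) - snd (base_data 0 i)\<bar> \<le> (if i = 1 then s else r))" by measurable
  qed simp
  then have i: "(\<lambda>\<omega>. indicator (data_box n r s) (\<lambda>i. X i \<omega>) :: ennreal) \<in> borel_measurable N"
    unfolding indicator_def of_bool_def by measurable
  have "(\<lambda>\<omega>. inverse (ennreal \<bar>tls_curv n (\<lambda>i. fst (X i \<omega>)) (\<lambda>i. snd (X i \<omega>))\<bar>)) \<in> borel_measurable N"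
    by (rule measurable_compose[OF _ borel_measurable_continuous_onI[OF continuous_on_inverse_ennreal[OF continuous_on_id]]])
      measurable
  then show ?thesis unfolding singular_def by (intro borel_measurable_times_ennreal i)
qed

lemma density_positive_box:
  fixes f :: "real \<times> real \<Rightarrow> real"
  assumes f: "continuous_on UNIV f" "\<And>z. 0 < f z" and r: "0 < r"
  shows "0 < emeasure (density lborel (\<lambda>z. ennreal (f z))) (cbox (p - (r, r)) (p + (r, r)))"
proof -
  let ?B = "cbox (p - (r, r)) (p + (r, r))"
  have [measurable]: "f \<in> borel_measurable borel" using f(1) by (rule borel_measurable_continuous_onI)
  have ne: "p \<in> ?B" using r by (cases p) (auto simp: cbox_Pair_eq)
  obtain c where c: "0 < c" "\<And>z. z \<in> ?B \<Longrightarrow> c \<le> f z"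
  proof -
    have "\<exists>z\<in>?B. \<forall>w\<in>?B. f z \<le> f w"
      by (rule continuous_attains_inf) (use ne f(1) in \<open>auto intro: continuous_on_subset\<close>)
    then show thesis using f(2) that by blast
  qed
  have "emeasure lborel ?B = ennreal (2 * r * (2 * r))"
    using r by (cases p) (simp add: emeasure_lborel_cbox_eq Basis_prod_def inner_Pair_0 ennreal_mult)
  then have "0 < ennreal c * emeasure lborel ?B" using c r by (simp add: ennreal_zero_less_mult_iff)
  also have "\<dots> = (\<integral>\<^sup>+z. ennreal c * indicator ?B z \<partial>lborel)" by (simp add: nn_integral_cmult_indicator)
  also have "\<dots> \<le> (\<integral>\<^sup>+z. ennreal (f z) * indicator ?B z \<partial>lborel)"
    by (intro nn_integral_mono) (auto split: split_indicator intro: ennreal_leI c)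
  also have "\<dots> = emeasure (density lborel (\<lambda>z. ennreal (f z))) ?B" by (simp add: emeasure_density)
  finally show ?thesis .
qed

text \<open>Fubini: the first error is split off, and its second coordinate is integrated innermost.
  If the other errors lie in the box Q, which has positive measure, each vertical segment of first
  errors carries a sign change of the curvature term, so the inner integral is infinite. The shift c
  stands for the true points.\<close>

lemma nn_integral_singular_shift:
  fixes f :: "nat \<Rightarrow> real \<times> real \<Rightarrow> real" and c :: "nat \<Rightarrow> real \<times> real"
  assumes n: "3 \<le> n" and rs: "0 < r" "0 < s"
    and lip: "\<And>D D'. D \<in> data_box n r s \<Longrightarrow> D' \<in> data_box n r s \<Longrightarrow>
           \<bar>tls_curv n (xs D) (ys D) - tls_curv n (xs D') (ys D')\<bar> \<le> L * gap n D D'"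
    and pos: "\<And>D. D \<in> data_box n r s \<Longrightarrow> snd (D 1) = -1 + s \<Longrightarrow> 0 < tls_curv n (xs D) (ys D)"
    and neg: "\<And>D. D \<in> data_box n r s \<Longrightarrow> snd (D 1) = -1 + - s \<Longrightarrow> tls_curv n (xs D) (ys D) < 0"
    and f: "\<And>i. continuous_on UNIV (f i)" "\<And>i z. 0 < f i z"
    and prob: "\<And>i. prob_space (density lborel (\<lambda>z. ennreal (f i z)))"
  shows "(\<integral>\<^sup>+e. singular n r s (\<lambda>i. c i + e i) \<partial>(\<Pi>\<^sub>M i\<in>{1..n}. density lborel (\<lambda>z. ennreal (f i z)))) = \<infinity>"
proof -
  let ?\<mu> = "\<lambda>i. density lborel (\<lambda>z. ennreal (f i z))"
  interpret product_sigma_finite ?\<mu>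
    using prob by (simp add: product_sigma_finite_def prob_space_imp_sigma_finite)
  have [measurable]: "f i \<in> borel_measurable borel" for i using f(1) by (rule borel_measurable_continuous_onI)
  have I: "{1..n} = insert 1 {2..n}" using n by auto
  define g where "g x e = singular n r s (\<lambda>i. c i + (x(1 := e)) i)" for x e
  \<comment> \<open>The first error that moves the first point exactly to its reference
    position.\<close>
  define a where "a = (-1, -1) - c 1"
  define Q where "Q = (\<Pi>\<^sub>E i\<in>{2..n}. cbox ((base_data 0 i - c i) - (r, r)) ((base_data 0 i - c i) + (r, r)))"
  have gm: "g x \<in> borel_measurable borel" for x
    unfolding g_def by (rule measurable_singular) auto
  have coord: "(\<lambda>e. e i) \<in> borel_measurable (\<Pi>\<^sub>M i\<in>{1..n}. ?\<mu> i)" if "i \<in> {1..n}" for i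
  proof -
    have "borel_measurable N = measurable N (?\<mu> i)" for N :: "(nat \<Rightarrow> real \<times> real) measure"
      by (rule measurable_cong_sets) auto
    then show ?thesis using measurable_component_singleton[OF that, of ?\<mu>] by blast
  qed
  have inner: "(\<integral>\<^sup>+e. g x e \<partial>?\<mu> 1) = \<infinity>" if x: "x \<in> Q" for x
  proof -
    let ?B = "cbox (a - (r, s)) (a + (r, s))"
    have ne: "a \<in> ?B" using rs by (cases a) (auto simp: cbox_Pair_eq)
    obtain k where k: "0 < k" "\<And>z. z \<in> ?B \<Longrightarrow> k \<le> f 1 z"
    proof -
      have "\<exists>z\<in>?B. \<forall>w\<in>?B. f 1 z \<le> f 1 w"
        by (rule continuous_attains_inf) (use ne f(1) in \<open>auto intro: continuous_on_subset\<close>)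
      then show thesis using f(2) that by blast
    qed
    define D where "D e i = c i + (x(1 := e)) i" for e i
    \<comment> \<open>With the other errors in Q, membership in the data box depends on the first
      error alone.\<close>
    have Dbox: "D e \<in> data_box n r s \<longleftrightarrow> e \<in> ?B" for e
    proof -
      have "\<bar>fst (D e i) - fst (base_data 0 i)\<bar> \<le> r \<and> \<bar>snd (D e i) - snd (base_data 0 i)\<bar> \<le> r" if "i \<in> {2..n}" for i
      proof -
        have "x i \<in> cbox ((base_data 0 i - c i) - (r, r)) ((base_data 0 i - c i) + (r, r))"
          using x that by (auto simp: Q_def PiE_iff)
        then have "fst (x i) \<in> {fst (base_data 0 i) - fst (c i) - r..fst (base_data 0 i) - fst (c i) + r}"
          "snd (x i) \<in> {snd (base_data 0 i) - snd (c i) - r..snd (base_data 0 i) - snd (c i) + r}"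
          by (cases "x i"; cases "base_data 0 i"; cases "c i"; auto simp: cbox_Pair_eq)+
        then show ?thesis using that by (auto simp: D_def abs_le_iff)
      qed
      moreover have "\<bar>fst (D e 1) - fst (base_data 0 1)\<bar> \<le> r \<and> \<bar>snd (D e 1) - snd (base_data 0 1)\<bar> \<le> s \<longleftrightarrow> e \<in> ?B"
        by (cases e; cases "c 1") (auto simp: D_def base_data_def a_def cbox_Pair_eq abs_le_iff)
      ultimately show ?thesis unfolding data_box_def I by auto
    qed
    \<comment> \<open>For fixed u, varying v moves only the second coordinate of the first point, so
      the gap of two such data sets is |v - w|.\<close>
    have slice: "(\<integral>\<^sup>+v. g x (u, v) \<partial>lborel) = \<infinity>" if u: "u \<in> {fst a - r..fst a + r}" for u
    proof -
      define h where "h v = tls_curv n (xs (D (u, v))) (ys (D (u, v)))" for v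
      have b: "D (u, v) \<in> data_box n r s \<longleftrightarrow> v \<in> {snd a - s..snd a + s}" for v
        unfolding Dbox using u by (cases a) (auto simp: cbox_Pair_eq)
      have gp: "gap n (D (u, v)) (D (u, w)) = \<bar>v - w\<bar>" for v w
      proof -
        have "gap n (D (u, v)) (D (u, w)) = (\<Sum>i=1..n. if i = 1 then \<bar>v - w\<bar> else 0)"
          unfolding gap_def by (rule sum.cong) (auto simp: D_def)
        then show ?thesis using n by simp
      qed
      have "(\<integral>\<^sup>+v. inverse (ennreal \<bar>h v\<bar>) * indicator {snd a - s..snd a + s} v \<partial>lborel) = \<infinity>"
      proof (rule nn_integral_inverse_zero[where L=L])
        show "\<bar>h v - h w\<bar> \<le> L * \<bar>v - w\<bar>" if "v \<in> {snd a - s..snd a + s}" "w \<in> {snd a - s..snd a + s}" for v w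
          using lip[of "D (u, v)" "D (u, w)"] that unfolding b h_def gp by blast
        show "0 < h (snd a + s)" unfolding h_def
        proof (rule pos)
          show "D (u, snd a + s) \<in> data_box n r s" unfolding b using rs by simp
        qed (simp add: D_def a_def)
        show "h (snd a - s) < 0" unfolding h_def
        proof (rule neg)
          show "D (u, snd a - s) \<in> data_box n r s" unfolding b using rs by simp
        qed (simp add: D_def a_def)
      qed (use rs in simp)
      moreover have "g x (u, v) = inverse (ennreal \<bar>h v\<bar>) * indicator {snd a - s..snd a + s} v" for v
        using b[of v] unfolding g_def singular_def h_def D_def[symmetric]
        by (auto simp: indicator_def)
      ultimately show ?thesis by simp
    qed
    have gm2: "g x \<in> borel_measurable (lborel \<Otimes>\<^sub>M lborel)"
      unfolding lborel_prod using gm[of x] by simp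
    have "\<infinity> = (\<integral>\<^sup>+u. \<infinity> * indicator {fst a - r..fst a + r} u \<partial>lborel)"
      using rs by (subst nn_integral_cmult_indicator) (auto simp: ennreal_top_mult)
    also have "\<dots> \<le> (\<integral>\<^sup>+u. (\<integral>\<^sup>+v. g x (u, v) \<partial>lborel) \<partial>lborel)"
      by (intro nn_integral_mono) (auto split: split_indicator simp: slice)
    also have "\<dots> = (\<integral>\<^sup>+e. g x e \<partial>lborel)"
      using lborel.nn_integral_fst[OF gm2] by (simp add: lborel_prod)
    finally have "(\<integral>\<^sup>+e. g x e \<partial>lborel) = \<infinity>" by (simp add: top_unique)
    then have "\<infinity> = (\<integral>\<^sup>+e. ennreal k * g x e \<partial>lborel)"
      using k gm[of x] by (subst nn_integral_cmult) (auto simp: ennreal_mult_top)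
    \<comment> \<open>The density is at least k on the box, and g vanishes outside it.\<close>
    also have "\<dots> \<le> (\<integral>\<^sup>+e. ennreal (f 1 e) * g x e \<partial>lborel)"
    proof (rule nn_integral_mono)
      fix e
      show "ennreal k * g x e \<le> ennreal (f 1 e) * g x e"
      proof (cases "e \<in> ?B")
        case True
        then show ?thesis by (intro mult_right_mono ennreal_leI k) auto
      next
        case False
        then have "g x e = 0" using Dbox[of e] unfolding g_def singular_def D_def[symmetric] by (simp add: indicator_def)
        then show ?thesis by simp
      qed
    qed
    also have "\<dots> = (\<integral>\<^sup>+e. g x e \<partial>?\<mu> 1)" using gm[of x] by (subst nn_integral_density) auto
    finally show ?thesis by (simp add: top_unique)
  qed
  have Qs: "Q \<in> sets (\<Pi>\<^sub>M i\<in>{2..n}. ?\<mu> i)" unfolding Q_def by (intro sets_PiM_I_finite) auto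
  have "emeasure (\<Pi>\<^sub>M i\<in>{2..n}. ?\<mu> i) Q =
      (\<Prod>i=2..n. emeasure (?\<mu> i) (cbox ((base_data 0 i - c i) - (r, r)) ((base_data 0 i - c i) + (r, r))))"
    unfolding Q_def by (rule emeasure_PiM) auto
  moreover have "\<dots> \<noteq> 0"
    using density_positive_box[OF f rs(1)] by (simp add: prod_zero_iff less_le)
  ultimately have "\<infinity> = (\<integral>\<^sup>+x. \<infinity> * indicator Q x \<partial>(\<Pi>\<^sub>M i\<in>{2..n}. ?\<mu> i))"
    using Qs by (subst nn_integral_cmult_indicator) (auto simp: ennreal_top_mult)
  also have "\<dots> \<le> (\<integral>\<^sup>+x. (\<integral>\<^sup>+e. g x e \<partial>?\<mu> 1) \<partial>(\<Pi>\<^sub>M i\<in>{2..n}. ?\<mu> i))"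
  proof (rule nn_integral_mono)
    show "\<infinity> * indicator Q x \<le> (\<integral>\<^sup>+e. g x e \<partial>?\<mu> 1)" for x
    proof (cases "x \<in> Q")
      case True
      show ?thesis unfolding inner[OF True] by simp
    qed simp
  qed
  also have "\<dots> = (\<integral>\<^sup>+e. singular n r s (\<lambda>i. c i + e i) \<partial>(\<Pi>\<^sub>M i\<in>{1..n}. ?\<mu> i))"
    unfolding g_def I
  proof (rule product_nn_integral_insert[symmetric])
    show "(\<lambda>e. singular n r s (\<lambda>i. c i + e i)) \<in> borel_measurable (Pi\<^sub>M (insert 1 {2..n}) ?\<mu>)"
      unfolding I[symmetric] by (rule measurable_singular) (intro borel_measurable_add borel_measurable_const coord)
  qed auto
  finally show ?thesis by (simp add: top_unique)
qed

text \<open>Outside the data box the left-hand side is 0, so the bound holds for all data and can be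
  integrated over the whole space.\<close>

lemma singular_le:
  assumes n: "3 \<le> n"
    and col: "\<And>D. D \<in> data_box n r s \<Longrightarrow> nearly_collinear n (xs D) (ys D)"
    and best: "best_fit_params n x y a b R" and z: "z \<in> {\<bar>a\<bar>, \<bar>b\<bar>, R}"
  shows "singular n r s (\<lambda>i. (x i, y i)) \<le> ennreal 86400 * e2ennreal z"
proof (cases "(\<lambda>i. (x i, y i)) \<in> data_box n r s")
  case True
  from col[OF True] have "nearly_collinear n x y" by simp
  then have "inverse (ennreal \<bar>tls_curv n x y\<bar>) \<le> ennreal 86400 * e2ennreal z"
    unfolding nearly_collinear_def by (intro best_fit_params_bound[OF n best]) (use z in auto)
  then show ?thesis using True by (simp add: singular_def)
qed (simp add: singular_def)

text \<open>Joint law of two independent variables with different value types. Independence of the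
  generated sigma-algebras gives the product formula on rectangles, which determines the
  measure.\<close>

lemma (in prob_space) distr_pair_indep_set:
  assumes X[measurable]: "X \<in> measurable M S" and Y[measurable]: "Y \<in> measurable M T"
    and indep: "indep_set (sets (vimage_algebra (space M) X S)) (sets (vimage_algebra (space M) Y T))"
  shows "distr M (S \<Otimes>\<^sub>M T) (\<lambda>\<omega>. (X \<omega>, Y \<omega>)) = distr M S X \<Otimes>\<^sub>M distr M T Y"
proof (rule pair_measure_eqI[symmetric])
  show "sigma_finite_measure (distr M S X)" "sigma_finite_measure (distr M T Y)"
    by (intro prob_space_imp_sigma_finite prob_space_distr X Y)+
  show "sets (distr M S X \<Otimes>\<^sub>M distr M T Y) = sets (distr M (S \<Otimes>\<^sub>M T) (\<lambda>\<omega>. (X \<omega>, Y \<omega>)))" by simp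
next
  fix A B assume "A \<in> sets (distr M S X)" "B \<in> sets (distr M T Y)"
  then have A: "A \<in> sets S" and B: "B \<in> sets T" by auto
  have "prob ((X -` A \<inter> space M) \<inter> (Y -` B \<inter> space M)) = prob (X -` A \<inter> space M) * prob (Y -` B \<inter> space M)"
    by (rule indep_setD[OF indep]) (intro in_vimage_algebra A B)+
  moreover have "(\<lambda>\<omega>. (X \<omega>, Y \<omega>)) -` (A \<times> B) \<inter> space M = (X -` A \<inter> space M) \<inter> (Y -` B \<inter> space M)" by auto
  ultimately show "emeasure (distr M S X) A * emeasure (distr M T Y) B =
      emeasure (distr M (S \<Otimes>\<^sub>M T) (\<lambda>\<omega>. (X \<omega>, Y \<omega>))) (A \<times> B)"
    using A B by (simp add: emeasure_distr emeasure_eq_measure ennreal_mult)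
qed

theorem theorem1:
  fixes M :: "'w measure"
    and n :: nat
    and a_star b_star R_star :: real
    and \<phi> \<delta> \<epsilon> x y :: "nat \<Rightarrow> 'w \<Rightarrow> real"
    and a_hat b_hat R_hat :: "'w \<Rightarrow> ereal"
  assumes "prob_space M"
    and "n \<ge> 3"
    and "R_star > 0"
    and angles: "functional_model M n \<phi> \<or> structural_model M n \<phi> (\<lambda>i \<omega>. (\<delta> i \<omega>, \<epsilon> i \<omega>))"
    and x: "\<And>i \<omega>. i \<in> {1..n} \<Longrightarrow> \<omega> \<in> space M \<Longrightarrow>
              x i \<omega> = (a_star + R_star * cos (\<phi> i \<omega>)) + \<delta> i \<omega>"
    and y: "\<And>i \<omega>. i \<in> {1..n} \<Longrightarrow> \<omega> \<in> space M \<Longrightarrow>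
              y i \<omega> = (b_star + R_star * sin (\<phi> i \<omega>)) + \<epsilon> i \<omega>"
    and indep: "prob_space.indep_vars M (\<lambda>_. borel) (\<lambda>i \<omega>. (\<delta> i \<omega>, \<epsilon> i \<omega>)) {1..n}"
    and density: "\<And>i. i \<in> {1..n} \<Longrightarrow>
          \<exists>f :: real \<times> real \<Rightarrow> real. continuous_on UNIV f \<and> (\<forall>z. f z > 0) \<and>
            distributed M lborel (\<lambda>\<omega>. (\<delta> i \<omega>, \<epsilon> i \<omega>)) (\<lambda>z. ennreal (f z))"
    and "a_hat \<in> borel_measurable M"
    and "b_hat \<in> borel_measurable M"
    and "R_hat \<in> borel_measurable M"
    and fit: "\<And>\<omega>. \<omega> \<in> space M \<Longrightarrow>
          best_fit_params n (\<lambda>i. x i \<omega>) (\<lambda>i. y i \<omega>) (a_hat \<omega>) (b_hat \<omega>) (R_hat \<omega>)"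
  shows "(\<integral>\<^sup>+\<omega>. e2ennreal \<bar>a_hat \<omega>\<bar> \<partial>M) = \<infinity> \<and>
         (\<integral>\<^sup>+\<omega>. e2ennreal \<bar>b_hat \<omega>\<bar> \<partial>M) = \<infinity> \<and>
         (\<integral>\<^sup>+\<omega>. e2ennreal (R_hat \<omega>) \<partial>M) = \<infinity>"
proof -
  interpret prob_space M by fact
  have n: "3 \<le> n" by fact
  let ?I = "{1..n}"
  let ?err = "\<lambda>i \<omega>. (\<delta> i \<omega>, \<epsilon> i \<omega>)"
  from density obtain f0 where f0: "\<And>i. i \<in> ?I \<Longrightarrow> continuous_on UNIV (f0 i)" "\<And>i z. i \<in> ?I \<Longrightarrow> 0 < f0 i z"
    "\<And>i. i \<in> ?I \<Longrightarrow> distributed M lborel (?err i) (\<lambda>z. ennreal (f0 i z))" by metis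
  \<comment> \<open>Indices outside {1..n} copy the density of index 1, so that every factor of the
    product family is a probability measure.\<close>
  define f where "f i = f0 (if i \<in> ?I then i else 1)" for i
  define \<mu> where "\<mu> i = density lborel (\<lambda>z. ennreal (f i z))" for i
  have f: "continuous_on UNIV (f i)" "0 < f i z" for i z
    using f0(1,2)[of "if i \<in> ?I then i else 1"] n by (auto simp: f_def)
  have err[measurable]: "?err i \<in> borel_measurable M" if "i \<in> ?I" for i
    using distributed_measurable[OF f0(3)[OF that]] by simp
  have law1: "distr M borel (?err i) = \<mu> i" if "i \<in> ?I" for i
  proof -
    have "distr M borel (?err i) = distr M lborel (?err i)" by (rule distr_cong) auto
    then show ?thesis using distributed_distr_eq_density[OF f0(3)[OF that]] that by (simp add: \<mu>_def f_def)
  qed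
  have prob: "prob_space (\<mu> i)" for i
  proof -
    let ?j = "if i \<in> ?I then i else 1"
    have j: "?j \<in> ?I" using n by auto
    then have "\<mu> i = \<mu> ?j" by (simp add: \<mu>_def f_def)
    then show ?thesis using law1[OF j] prob_space_distr[OF err[OF j]] by simp
  qed
  let ?E = "\<Pi>\<^sub>M i\<in>?I. (borel :: (real \<times> real) measure)"
  define \<eta> where "\<eta> \<omega> = (\<lambda>i\<in>?I. ?err i \<omega>)" for \<omega>
  have \<eta>[measurable]: "\<eta> \<in> measurable M ?E" unfolding \<eta>_def by (intro measurable_restrict err)
  have "distr M ?E \<eta> = (\<Pi>\<^sub>M i\<in>?I. distr M borel (?err i))"
    using indep_vars_iff_distr_eq_PiM'[where M'="\<lambda>_. borel" and X="?err" and I="?I"] err indep n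
    unfolding \<eta>_def by auto
  also have "\<dots> = PiM ?I \<mu>" by (rule PiM_cong) (auto simp: law1)
  finally have law: "distr M ?E \<eta> = PiM ?I \<mu>" .
  obtain r s L where rs: "0 < r" "0 < s" "0 \<le> L"
    and col: "\<And>D. D \<in> data_box n r s \<Longrightarrow> nearly_collinear n (xs D) (ys D)"
    and L: "\<And>D D'. D \<in> data_box n r s \<Longrightarrow> D' \<in> data_box n r s \<Longrightarrow>
           \<bar>tls_curv n (xs D) (ys D) - tls_curv n (xs D') (ys D')\<bar> \<le> L * gap n D D'"
    and pn: "\<And>D. D \<in> data_box n r s \<Longrightarrow> snd (D 1) = -1 + s \<Longrightarrow> 0 < tls_curv n (xs D) (ys D)"
      "\<And>D. D \<in> data_box n r s \<Longrightarrow> snd (D 1) = -1 + - s \<Longrightarrow> tls_curv n (xs D) (ys D) < 0"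
    by (rule collinear_data_box[OF n]) blast
  \<comment> \<open>The divergence holds for every fixed position of the true points, hence for
    every choice of the angles.\<close>
  have shift: "(\<integral>\<^sup>+e. singular n r s (\<lambda>i. c i + e i) \<partial>distr M ?E \<eta>) = \<infinity>" for c
    unfolding law \<mu>_def
    by (rule nn_integral_singular_shift[OF n rs(1,2) L pn f]) (use prob in \<open>auto simp: \<mu>_def\<close>)
  define p where "p t i = (a_star + R_star * cos (t i), b_star + R_star * sin (t i))" for t :: "nat \<Rightarrow> real" and i
  have data: "singular n r s (\<lambda>i. (x i \<omega>, y i \<omega>)) = singular n r s (\<lambda>i. p t i + \<eta> \<omega> i)"
    if "\<omega> \<in> space M" "\<And>i. i \<in> ?I \<Longrightarrow> \<phi> i \<omega> = t i" for \<omega> t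
    by (rule singular_cong) (use that in \<open>simp add: x y p_def \<eta>_def\<close>)
  have coord: "(\<lambda>e. e i) \<in> borel_measurable ?E" if "i \<in> ?I" for i
    by (rule measurable_component_singleton[OF that])
  have inf: "(\<integral>\<^sup>+\<omega>. singular n r s (\<lambda>i. (x i \<omega>, y i \<omega>)) \<partial>M) = \<infinity>"
    using angles
  proof
    assume "functional_model M n \<phi>"
    then obtain t where t: "\<And>i \<omega>. i \<in> ?I \<Longrightarrow> \<omega> \<in> space M \<Longrightarrow> \<phi> i \<omega> = t i"
      unfolding functional_model_def by blast
    have "(\<integral>\<^sup>+\<omega>. singular n r s (\<lambda>i. (x i \<omega>, y i \<omega>)) \<partial>M) = (\<integral>\<^sup>+\<omega>. singular n r s (\<lambda>i. p t i + \<eta> \<omega> i) \<partial>M)"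
      by (intro nn_integral_cong data t)
    also have "\<dots> = (\<integral>\<^sup>+e. singular n r s (\<lambda>i. p t i + e i) \<partial>distr M ?E \<eta>)"
    proof (rule nn_integral_distr[symmetric, OF \<eta>])
      have "(\<lambda>e. singular n r s (\<lambda>i. p t i + e i)) \<in> borel_measurable ?E"
        by (rule measurable_singular, intro borel_measurable_add borel_measurable_const coord)
      then show "(\<lambda>e. singular n r s (\<lambda>i. p t i + e i)) \<in> borel_measurable (distr M ?E \<eta>)" by simp
    qed
    finally show ?thesis unfolding shift .
  next
    assume S: "structural_model M n \<phi> ?err"
    let ?T = "\<Pi>\<^sub>M i\<in>?I. (borel :: real measure)"
    define \<Phi> where "\<Phi> \<omega> = (\<lambda>i\<in>?I. \<phi> i \<omega>)" for \<omega>
    have "\<phi> i \<in> borel_measurable M" if "i \<in> ?I" for i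
      using S that unfolding structural_model_def indep_vars_def2 by auto
    then have \<Phi>[measurable]: "\<Phi> \<in> measurable M ?T" unfolding \<Phi>_def by (intro measurable_restrict)
    have "indep_set (sets (vimage_algebra (space M) \<Phi> ?T)) (sets (vimage_algebra (space M) \<eta> ?E))"
      using S unfolding structural_model_def \<Phi>_def \<eta>_def by blast
    note pair = distr_pair_indep_set[OF \<Phi> \<eta> this]
    interpret N: prob_space "distr M ?E \<eta>" by (rule prob_space_distr[OF \<eta>])
    interpret A: prob_space "distr M ?T \<Phi>" by (rule prob_space_distr[OF \<Phi>])
    let ?g = "\<lambda>q. singular n r s (\<lambda>i. p (fst q) i + snd q i)"
    have g: "?g \<in> borel_measurable (?T \<Otimes>\<^sub>M ?E)"
    proof (rule measurable_singular)
      fix i assume i: "i \<in> ?I"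
      have [measurable]: "(\<lambda>q. fst q i) \<in> borel_measurable (?T \<Otimes>\<^sub>M ?E)"
        by (rule measurable_compose[OF measurable_fst measurable_component_singleton[OF i]])
      have 2: "(\<lambda>q. snd q i) \<in> borel_measurable (?T \<Otimes>\<^sub>M ?E)"
        by (rule measurable_compose[OF measurable_snd measurable_component_singleton[OF i]])
      have "(\<lambda>q. p (fst q) i) \<in> borel_measurable (?T \<Otimes>\<^sub>M ?E)"
        unfolding p_def by (intro borel_measurable_Pair) measurable
      then show "(\<lambda>q. p (fst q) i + snd q i) \<in> borel_measurable (?T \<Otimes>\<^sub>M ?E)"
        by (intro borel_measurable_add 2)
    qed
    have "(\<integral>\<^sup>+\<omega>. singular n r s (\<lambda>i. (x i \<omega>, y i \<omega>)) \<partial>M) = (\<integral>\<^sup>+\<omega>. ?g (\<Phi> \<omega>, \<eta> \<omega>) \<partial>M)"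
    proof (rule nn_integral_cong)
      show "singular n r s (\<lambda>i. (x i \<omega>, y i \<omega>)) = ?g (\<Phi> \<omega>, \<eta> \<omega>)" if "\<omega> \<in> space M" for \<omega>
        using data[OF that, of "\<Phi> \<omega>"] by (simp add: \<Phi>_def)
    qed
    also have "\<dots> = (\<integral>\<^sup>+q. ?g q \<partial>distr M (?T \<Otimes>\<^sub>M ?E) (\<lambda>\<omega>. (\<Phi> \<omega>, \<eta> \<omega>)))"
      using g by (intro nn_integral_distr[symmetric]) measurable
    also have "\<dots> = (\<integral>\<^sup>+t. \<integral>\<^sup>+e. ?g (t, e) \<partial>distr M ?E \<eta> \<partial>distr M ?T \<Phi>)"
      unfolding pair
      by (rule N.nn_integral_fst[symmetric]) (use g in \<open>simp cong: measurable_cong_sets\<close>)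
    \<comment> \<open>The inner integral is infinite for every t, and the law of the angles has
      total mass 1.\<close>
    also have "\<dots> = \<infinity>" 
      unfolding fst_conv snd_conv shift nn_integral_const A.emeasure_space_1 by simp
    finally show ?thesis .
  qed
  \<comment> \<open>A finite constant times the expectation dominates an infinite integral, so the
    expectation itself is infinite.\<close>
  have main: "(\<integral>\<^sup>+\<omega>. e2ennreal (z \<omega>) \<partial>M) = \<infinity>"
    if z[measurable]: "z \<in> borel_measurable M" and "\<And>\<omega>. z \<omega> \<in> {\<bar>a_hat \<omega>\<bar>, \<bar>b_hat \<omega>\<bar>, R_hat \<omega>}" for z
  proof -
    have "\<infinity> \<le> (\<integral>\<^sup>+\<omega>. ennreal 86400 * e2ennreal (z \<omega>) \<partial>M)"
      unfolding inf[symmetric] by (intro nn_integral_mono singular_le[OF n col fit that(2)])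
    also have "\<dots> = ennreal 86400 * (\<integral>\<^sup>+\<omega>. e2ennreal (z \<omega>) \<partial>M)" by (rule nn_integral_cmult) measurable
    finally show ?thesis by (simp add: top_unique ennreal_mult_eq_top_iff)
  qed
  note [measurable] = assms(9,10)
  have "(\<lambda>\<omega>. \<bar>a_hat \<omega>\<bar>) \<in> borel_measurable M" "(\<lambda>\<omega>. \<bar>b_hat \<omega>\<bar>) \<in> borel_measurable M"
    by measurable
  then show ?thesis using assms(11) by (intro conjI main) auto
qed

end
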